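(* Let $K$ be a field, let $L$ be a finite modular non-distributive lattice, let $S=K[L]=K[x_a : a\in L]$, and let $I_L\subset S$ be the join-meet ideal of $L$. Then: (i) $\operatorname{reg}(S/I_L)\geq 3$; (ii) $\beta_{24}(S/I_L)>0$, and thus $I_L$ is not a linearly related ideal. In particular, $S/I_L$ does not have a linear resolution.
   Context: For a finite lattice $L$ and a field $K$, $K[L]=K[x_a : a\in L]$ is the polynomial ring over $K$ with one variable $x_a$ of degree $1$ for each $a\in L$, with the standard grading. The join-meet ideal of $L$ is $$I_L=(x_ax_b-x_{a\wedge b}x_{a\vee b} : a,b\in L,\ a,b \text{ incomparable})\subset K[L].$$ For a finitely generated graded $S$-module $M$, $\beta_{ij}(M)=\dim_K \operatorname{Tor}_i^S(M,K)_j$ are the graded Betti numbers and $\operatorname{reg}(M)=\max\{j-i : \beta_{ij}(M)\neq 0\}$ is the Castelnuovo–Mumford regularity. A homogeneous ideal $I$ of a polynomial ring $R$ generated in a single degree $d$ is called linearly related if its syzygy module is generated by linear relations, i.e. if $\beta_{2j}(R/I)=0$ for all $j\geq d+2$. For the ideal $I_L$, which is generated in degree $2$, having a linear resolution (of $S/I_L$, equivalently of $I_L$) means that $\beta_{ij}(S/I_L)=0$ for all $i\geq 1$ and $j\neq i+1$. *)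

theory Defs
  imports
    "HOL-Library.Poly_Mapping"
    "HOL-Library.Extended_Real"
begin

section \<open>Polynomial rings and free modules\<close>

type_synonym ('a, 'k) mpolynomial = "('a \<Rightarrow>\<^sub>0 nat) \<Rightarrow>\<^sub>0 'k"

definition var :: "'a \<Rightarrow> ('a, 'k::comm_ring_1) mpolynomial" where
  "var a = Poly_Mapping.single (Poly_Mapping.single a 1) 1"

definition monomial_degree :: "('a \<Rightarrow>\<^sub>0 nat) \<Rightarrow> nat" where
  "monomial_degree m = (\<Sum>a\<in>Poly_Mapping.keys m. Poly_Mapping.lookup m a)"

definition homogeneous_part :: "nat \<Rightarrow> ('a, 'k::comm_ring_1) mpolynomial set" where
  "homogeneous_part d = {f. \<forall>m\<in>Poly_Mapping.keys f. monomial_degree m = d}"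

text \<open>Coordinatewise scalar multiplication on finitely supported functions, i.e. on the free
  module over the coefficient ring.  It is used both over the polynomial ring and over the
  ground field.\<close>

definition fscale :: "'r::comm_ring_1 \<Rightarrow> ('b \<Rightarrow>\<^sub>0 'r) \<Rightarrow> ('b \<Rightarrow>\<^sub>0 'r)" where
  "fscale c v = Poly_Mapping.map (\<lambda>x. c * x) v"

lemma lookup_fscale: "Poly_Mapping.lookup (fscale c v) b = c * Poly_Mapping.lookup v b"
  by (simp add: fscale_def Poly_Mapping.map.rep_eq when_def)

interpretation fmod: module "fscale :: 'r::comm_ring_1 \<Rightarrow> ('b \<Rightarrow>\<^sub>0 'r) \<Rightarrow> ('b \<Rightarrow>\<^sub>0 'r)"
  by standard (auto intro!: poly_mapping_eqI simp: lookup_fscale lookup_add algebra_simps)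

interpretation fvec: vector_space "fscale :: 'k::field \<Rightarrow> ('b \<Rightarrow>\<^sub>0 'k) \<Rightarrow> ('b \<Rightarrow>\<^sub>0 'k)"
  by standard (auto intro!: poly_mapping_eqI simp: lookup_fscale lookup_add algebra_simps)


section \<open>Graded free resolutions of $S/I$\<close>

text \<open>A sequence of graded free modules: the module in homological degree \<open>i\<close> has basis
  \<open>basis C i\<close>, the basis element \<open>b\<close> has degree \<open>shift C i b\<close>, and \<open>diff C i\<close> is the map from
  homological degree \<open>i + 1\<close> to \<open>i\<close>.  The maps are total on the ambient free module with basis
  all natural numbers; only their values on the span of the chosen bases matter.\<close>

record (overloaded) ('a, 'k) free_sequence =
  basis :: "nat \<Rightarrow> nat set"
  shift :: "nat \<Rightarrow> nat \<Rightarrow> nat"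
  diff :: "nat \<Rightarrow> (nat \<Rightarrow>\<^sub>0 (('a \<Rightarrow>\<^sub>0 nat) \<Rightarrow>\<^sub>0 'k)) \<Rightarrow> (nat \<Rightarrow>\<^sub>0 (('a \<Rightarrow>\<^sub>0 nat) \<Rightarrow>\<^sub>0 'k))"

definition free_part ::
    "('a, 'k::comm_ring_1) free_sequence \<Rightarrow> nat \<Rightarrow> (nat \<Rightarrow>\<^sub>0 ('a, 'k) mpolynomial) set" where
  "free_part C i = {v. Poly_Mapping.keys v \<subseteq> basis C i}"

definition free_graded_part ::
    "('a, 'k::comm_ring_1) free_sequence \<Rightarrow> nat \<Rightarrow> nat \<Rightarrow> (nat \<Rightarrow>\<^sub>0 ('a, 'k) mpolynomial) set" where
  "free_graded_part C i j =
     {v \<in> free_part C i. \<forall>b\<in>Poly_Mapping.keys v. \<forall>m\<in>Poly_Mapping.keys (Poly_Mapping.lookup v b).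
        monomial_degree m + shift C i b = j}"

text \<open>The augmentation from the free module \<open>F\<close> in homological degree \<open>0\<close> to $S/I$ is given by
  a lift \<open>\<epsilon>\<close> to $S$, which exists because \<open>F\<close> is free; so the last two conditions on \<open>\<epsilon>\<close> say
  that $F \to S/I$ is surjective and that its kernel is the image of \<open>diff C 0\<close>.  The free modules
  may have infinite rank, but only finitely many generators in each degree.\<close>

definition graded_free_resolution ::
    "('a, 'k::comm_ring_1) mpolynomial set \<Rightarrow> ('a, 'k) free_sequence \<Rightarrow> bool" where
  "graded_free_resolution I C \<longleftrightarrow>
     (\<forall>i j. finite {b \<in> basis C i. shift C i b = j}) \<and>
     (\<forall>i. module_hom fscale fscale (diff C i)) \<and>
     (\<forall>i j. diff C i ` free_graded_part C (Suc i) j \<subseteq> free_graded_part C i j) \<and>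
     (\<forall>i. {v \<in> free_part C (Suc i). diff C i v = 0} = diff C (Suc i) ` free_part C (Suc (Suc i))) \<and>
     (\<exists>\<epsilon>. module_hom fscale (*) \<epsilon> \<and>
          (\<forall>j. \<epsilon> ` free_graded_part C 0 j \<subseteq> homogeneous_part j) \<and>
          (\<forall>f. \<exists>v\<in>free_part C 0. f - \<epsilon> v \<in> I) \<and>
          {v \<in> free_part C 0. \<epsilon> v \<in> I} = diff C 0 ` free_part C (Suc 0))"


section \<open>Tor and graded Betti numbers\<close>

text \<open>Tensoring with $K = S/(x_a : a)$ turns the free $S$-module on a set of homogeneous basis
  elements into the $K$-vector space on the same basis, whose part of degree \<open>j\<close> is spanned by
  the basis elements of degree \<open>j\<close>, and turns an $S$-linear map into the map obtained by
  replacing every matrix entry by its constant coefficient.\<close>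

definition tensor_part ::
    "('a, 'k::field) free_sequence \<Rightarrow> nat \<Rightarrow> nat \<Rightarrow> (nat \<Rightarrow>\<^sub>0 'k) set" where
  "tensor_part C i j = {w. Poly_Mapping.keys w \<subseteq> {b \<in> basis C i. shift C i b = j}}"

definition tensor_diff ::
    "('a, 'k::field) free_sequence \<Rightarrow> nat \<Rightarrow> (nat \<Rightarrow>\<^sub>0 'k) \<Rightarrow> (nat \<Rightarrow>\<^sub>0 'k)" where
  "tensor_diff C i w =
     Poly_Mapping.map (\<lambda>f. Poly_Mapping.lookup f 0)
       (diff C i (Poly_Mapping.map (\<lambda>c. Poly_Mapping.single 0 c) w))"

fun tor_cycles :: "('a, 'k::field) free_sequence \<Rightarrow> nat \<Rightarrow> nat \<Rightarrow> (nat \<Rightarrow>\<^sub>0 'k) set" where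
  "tor_cycles C 0 j = tensor_part C 0 j"
| "tor_cycles C (Suc i) j = {w \<in> tensor_part C (Suc i) j. tensor_diff C i w = 0}"

definition tor_boundaries ::
    "('a, 'k::field) free_sequence \<Rightarrow> nat \<Rightarrow> nat \<Rightarrow> (nat \<Rightarrow>\<^sub>0 'k) set" where
  "tor_boundaries C i j = tensor_diff C i ` tensor_part C (Suc i) j"

text \<open>\<open>betti I i j\<close> is $\beta_{ij}(S/I) = \dim_K \mathrm{Tor}_i^S(S/I, K)_j$, for \<open>I\<close> a homogeneous
  ideal in finitely many variables.  The dimension of the homology, cycles modulo boundaries, is
  a difference of dimensions, since the spaces involved are finite-dimensional.  It does not
  depend on the resolution chosen.\<close>

definition betti :: "('a, 'k::field) mpolynomial set \<Rightarrow> nat \<Rightarrow> nat \<Rightarrow> nat" where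
  "betti I i j =
     (let C = (SOME C. graded_free_resolution I C)
      in fvec.dim (tor_cycles C i j) - fvec.dim (tor_boundaries C i j))"

text \<open>The regularity of $S/I$.  The maximum is written as a supremum in the extended reals, so
  that it is meaningful without first knowing that it is taken over a finite set.\<close>

definition regularity :: "('a, 'k::field) mpolynomial set \<Rightarrow> ereal" where
  "regularity I = (SUP (i, j)\<in>{(i, j). betti I i j \<noteq> 0}. ereal (real j - real i))"

text \<open>The following two notions are meant for an ideal \<open>I\<close> generated in the single degree \<open>d\<close>.\<close>

definition linearly_related :: "nat \<Rightarrow> ('a, 'k::field) mpolynomial set \<Rightarrow> bool" where
  "linearly_related d I \<longleftrightarrow> (\<forall>j\<ge>d + 2. betti I 2 j = 0)"

definition has_linear_resolution :: "nat \<Rightarrow> ('a, 'k::field) mpolynomial set \<Rightarrow> bool" where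
  "has_linear_resolution d I \<longleftrightarrow> (\<forall>i\<ge>1. \<forall>j. j + 1 \<noteq> i + d \<longrightarrow> betti I i j = 0)"


section \<open>Join-meet ideals\<close>

definition join_meet_ideal :: "('a::lattice, 'k::comm_ring_1) mpolynomial set" where
  "join_meet_ideal =
     module.span (*) {var a * var b - var (inf a b) * var (sup a b) | a b. \<not> a \<le> b \<and> \<not> b \<le> a}"

end

theory Submission
  imports Defs "HOL-Library.FuncSet"
begin

text \<open>
A modular lattice that is not distributive contains a diamond, and in a finite modular lattice the
diamond can be chosen with a bottom \<open>y\<close> and a top \<open>z\<close> such that the interval from \<open>y\<close> to \<open>z\<close> has
length two: any two distinct elements of the open interval \<open>N\<close> have meet \<open>y\<close> and join \<open>z\<close>, and \<open>N\<close>
has at least three elements (\<open>modular_covering_diamond\<close>).  Hence $st - yz \in I_L$ for distinct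
$s, t \in N$.  Both Betti numbers that matter come from this interval alone.

Since $\mathrm{Tor}_i^S(S/I, K)$ is also the homology of the Koszul complex of $S/I$, a nonzero graded
Betti number $\beta_{i,e+i}(S/I)$ is certified by two finite pieces of data: a chain \<open>c\<close> of Koszul
degree \<open>i\<close> with coefficients of degree \<open>e\<close> whose boundary has its coefficients in \<open>I\<close>, and a linear
functional on Koszul chains that vanishes on all chains with coefficients in \<open>I\<close> and on all
boundaries, but not on \<open>c\<close>.  This is \<open>koszul_class_imp_betti_pos\<close>.  Its proof does not compare Tor
with Koszul homology as a whole; for an arbitrary graded free resolution it follows one class through
the staircase of the double complex, and uses the exactness of the Koszul complex over free modules
(\<open>koszul_exact\<close>).  Betti numbers are defined through a chosen resolution, so that such a resolution
must exist; \<open>graded_free_resolution_exists\<close> builds one degree by degree, taking vector space bases of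
the graded pieces of the successive kernels as generators.

For $\beta_{24}$ the chain is the product of the Koszul cycles that belong to two of the relations,
$pr - yz$ and $pq - yz$, and the functional lives in the squarefree degree $pqyz$
(\<open>betti_2_4_pos\<close>).  Because $p$ and $q$ cover \<open>y\<close> and are covered by \<open>z\<close>, the monomials involved in it
do not occur in any multiple of a generator of $I_L$, wherever in $L$ the generator comes from.

For the regularity let $p \in N$ and $u = y^2z - p^2y$.  Modulo $I_L$ all products $s\,yz$ with
$s \in N$ agree, since $s\,yz = srt = t\,yz$, and so $u$ is annihilated by $z$ and by every
$s \in N - \{p\}$.  Therefore the exterior product of these $|N|$ variables, with coefficient $u$, is a
cycle of Koszul degree $|N|$ and total degree $|N| + 3$, and a functional shows that it is not a
boundary (\<open>betti_top_pos\<close>).  So $\beta_{|N|,|N|+3} \neq 0$ and the regularity is at least $3$.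
\<close>

section \<open>Homogeneous components\<close>

lemma monomial_degree_UNIV: "monomial_degree (m :: 'a::finite \<Rightarrow>\<^sub>0 nat) = (\<Sum>a\<in>UNIV. Poly_Mapping.lookup m a)"
  unfolding monomial_degree_def by (rule sum.mono_neutral_left) (auto simp: in_keys_iff)

lemma monomial_degree_zero [simp]: "monomial_degree 0 = 0"
  by (simp add: monomial_degree_def)

lemma monomial_degree_add [simp]:
  "monomial_degree (m + n :: 'a::finite \<Rightarrow>\<^sub>0 nat) = monomial_degree m + monomial_degree n"
  by (simp add: monomial_degree_UNIV lookup_add sum.distrib)

lemma monomial_degree_single [simp]: "monomial_degree (Poly_Mapping.single a k) = k"
  by (simp add: monomial_degree_def)

lemma monomial_degree_eq_0_iff [simp]: "monomial_degree m = 0 \<longleftrightarrow> m = 0"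
  by (auto simp: monomial_degree_def in_keys_iff intro!: poly_mapping_eqI)

lemma finite_monomials_of_degree: "finite {m :: 'a::finite \<Rightarrow>\<^sub>0 nat. monomial_degree m = d}"
proof -
  have le: "Poly_Mapping.lookup m a \<le> monomial_degree m" for m :: "'a \<Rightarrow>\<^sub>0 nat" and a
    unfolding monomial_degree_UNIV by (rule member_le_sum) simp_all
  have "finite (PiE (UNIV :: 'a set) (\<lambda>_. {..d}))"
    by (rule finite_PiE) simp_all
  moreover have "Poly_Mapping.lookup ` {m :: 'a \<Rightarrow>\<^sub>0 nat. monomial_degree m = d} \<subseteq> PiE UNIV (\<lambda>_. {..d})"
    using le by (intro image_subsetI PiE_I) auto
  ultimately have "finite (Poly_Mapping.lookup ` {m :: 'a \<Rightarrow>\<^sub>0 nat. monomial_degree m = d})"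
    by (rule finite_subset[rotated])
  moreover have "inj_on Poly_Mapping.lookup {m :: 'a \<Rightarrow>\<^sub>0 nat. monomial_degree m = d}"
    unfolding inj_on_def poly_mapping_eq_iff by blast
  ultimately show ?thesis
    by (rule finite_imageD)
qed

definition filter_keys :: "('b \<Rightarrow> bool) \<Rightarrow> ('b \<Rightarrow>\<^sub>0 'c::zero) \<Rightarrow> ('b \<Rightarrow>\<^sub>0 'c)" where
  "filter_keys P = Poly_Mapping.mapp (\<lambda>k x. x when P k)"

lemma lookup_filter_keys:
  "Poly_Mapping.lookup (filter_keys P p) k = (Poly_Mapping.lookup p k when P k)"
  by (simp add: filter_keys_def lookup_mapp when_def in_keys_iff)

lemma filter_keys_zero [simp]: "filter_keys P 0 = 0"
  by (rule poly_mapping_eqI) (simp add: lookup_filter_keys)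

lemma filter_keys_add: "filter_keys P (p + q) = filter_keys P p + filter_keys P (q :: 'b \<Rightarrow>\<^sub>0 'c::monoid_add)"
  by (rule poly_mapping_eqI) (simp add: lookup_filter_keys lookup_add when_def)

lemma filter_keys_sum:
  "filter_keys P (\<Sum>x\<in>X. f x) = (\<Sum>x\<in>X. filter_keys P (f x :: 'b \<Rightarrow>\<^sub>0 'c::comm_monoid_add))"
  by (induction X rule: infinite_finite_induct) (simp_all add: filter_keys_add)

lemma filter_keys_diff:
  "filter_keys P (p - q) = filter_keys P p - filter_keys P (q :: 'b \<Rightarrow>\<^sub>0 'c::ab_group_add)"
  by (rule poly_mapping_eqI) (simp add: lookup_filter_keys lookup_minus when_def)

lemma filter_keys_id: "(\<And>k. k \<in> Poly_Mapping.keys p \<Longrightarrow> P k) \<Longrightarrow> filter_keys P p = p"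
  by (rule poly_mapping_eqI) (auto simp: lookup_filter_keys in_keys_iff when_def)

lemma filter_keys_none: "(\<And>k. k \<in> Poly_Mapping.keys p \<Longrightarrow> \<not> P k) \<Longrightarrow> filter_keys P p = 0"
  by (rule poly_mapping_eqI) (auto simp: lookup_filter_keys in_keys_iff when_def)

definition degree_component ::
    "(nat \<Rightarrow> nat) \<Rightarrow> nat \<Rightarrow> (nat \<Rightarrow>\<^sub>0 ('a, 'k::zero) mpolynomial) \<Rightarrow> (nat \<Rightarrow>\<^sub>0 ('a, 'k) mpolynomial)" where
  "degree_component s j = Poly_Mapping.mapp (\<lambda>b. filter_keys (\<lambda>m. monomial_degree m + s b = j))"

definition graded_part ::
    "nat set \<Rightarrow> (nat \<Rightarrow> nat) \<Rightarrow> nat \<Rightarrow> (nat \<Rightarrow>\<^sub>0 ('a, 'k::comm_ring_1) mpolynomial) set" where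
  "graded_part B s j = {v. Poly_Mapping.keys v \<subseteq> B \<and> (\<forall>b\<in>Poly_Mapping.keys v.
     \<forall>m\<in>Poly_Mapping.keys (Poly_Mapping.lookup v b). monomial_degree m + s b = j)}"

lemma free_graded_part_eq: "free_graded_part C i j = graded_part (basis C i) (shift C i) j"
  by (auto simp: free_graded_part_def graded_part_def free_part_def)

lemma graded_partI:
  assumes "Poly_Mapping.keys v \<subseteq> B"
    and "\<And>b m. Poly_Mapping.lookup (Poly_Mapping.lookup v b) m \<noteq> 0 \<Longrightarrow> monomial_degree m + s b = j"
  shows "v \<in> graded_part B s j"
  using assms by (auto simp: graded_part_def in_keys_iff)

lemma graded_partD:
  assumes "v \<in> graded_part B s j" "Poly_Mapping.lookup (Poly_Mapping.lookup v b) m \<noteq> 0"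
  shows "monomial_degree m + s b = j"
proof -
  have "b \<in> Poly_Mapping.keys v" using assms(2) by (auto simp: in_keys_iff)
  then show ?thesis using assms by (auto simp: graded_part_def in_keys_iff)
qed

lemma lookup_degree_component:
  "Poly_Mapping.lookup (degree_component s j v) b =
     filter_keys (\<lambda>m. monomial_degree m + s b = j) (Poly_Mapping.lookup v b)"
  by (simp add: degree_component_def lookup_mapp when_def in_keys_iff)

lemma keys_degree_component: "Poly_Mapping.keys (degree_component s j v) \<subseteq> Poly_Mapping.keys v"
  by (auto simp: in_keys_iff lookup_degree_component)

lemma degree_component_zero [simp]: "degree_component s j 0 = 0"
  by (rule poly_mapping_eqI) (simp add: lookup_degree_component)

lemma degree_component_add:
  "degree_component s j (v + w) =
     degree_component s j v + degree_component s j (w :: nat \<Rightarrow>\<^sub>0 ('a, 'k::comm_ring_1) mpolynomial)"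
  by (rule poly_mapping_eqI) (simp add: lookup_degree_component lookup_add filter_keys_add)

lemma degree_component_sum:
  "degree_component s j (\<Sum>x\<in>X. f x :: nat \<Rightarrow>\<^sub>0 ('a, 'k::comm_ring_1) mpolynomial) =
     (\<Sum>x\<in>X. degree_component s j (f x))"
  by (induction X rule: infinite_finite_induct) (auto simp: degree_component_add)

lemma degree_component_in_graded_part:
  "Poly_Mapping.keys v \<subseteq> B \<Longrightarrow> degree_component s j v \<in> graded_part B s j"
  using keys_degree_component[of s j v]
  by (intro graded_partI) (auto simp: lookup_degree_component lookup_filter_keys)

lemma degree_component_graded:
  assumes "v \<in> graded_part B s i"
  shows "degree_component s j v = (if i = j then v else 0)"
proof (rule poly_mapping_eqI, rule poly_mapping_eqI)
  fix b m
  show "Poly_Mapping.lookup (Poly_Mapping.lookup (degree_component s j v) b) m =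
     Poly_Mapping.lookup (Poly_Mapping.lookup (if i = j then v else 0) b) m"
    using graded_partD[OF assms, of b m]
    by (auto simp: lookup_degree_component lookup_filter_keys when_def)
qed

lemma degree_decomposition:
  fixes v :: "nat \<Rightarrow>\<^sub>0 ('a, 'k::comm_ring_1) mpolynomial"
  shows "\<exists>J. finite J \<and> v = (\<Sum>j\<in>J. degree_component s j v)"
proof -
  define J where "J = (\<Union>b\<in>Poly_Mapping.keys v.
    (\<lambda>m. monomial_degree m + s b) ` Poly_Mapping.keys (Poly_Mapping.lookup v b))"
  have fin: "finite J" by (simp add: J_def)
  have "v = (\<Sum>j\<in>J. degree_component s j v)"
  proof (rule poly_mapping_eqI, rule poly_mapping_eqI)
    fix b m
    let ?c = "Poly_Mapping.lookup (Poly_Mapping.lookup v b) m"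
    have "monomial_degree m + s b \<in> J" if "?c \<noteq> 0"
    proof -
      from that have "m \<in> Poly_Mapping.keys (Poly_Mapping.lookup v b)" "b \<in> Poly_Mapping.keys v"
        by (auto simp: in_keys_iff)
      then show ?thesis unfolding J_def by blast
    qed
    then have "?c = (if monomial_degree m + s b \<in> J then ?c else 0)" by presburger
    also have "\<dots> = (\<Sum>j\<in>J. if monomial_degree m + s b = j then ?c else 0)"
      by (rule sum.delta'[OF fin, symmetric])
    finally show "?c = Poly_Mapping.lookup (Poly_Mapping.lookup (\<Sum>j\<in>J. degree_component s j v) b) m"
      unfolding lookup_sum lookup_degree_component lookup_filter_keys when_def .
  qed
  with fin show ?thesis by blast
qed

section \<open>Existence of graded free resolutions\<close>

lemma keys_fscale: "Poly_Mapping.keys (fscale c v) \<subseteq> Poly_Mapping.keys v"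
  by (auto simp: in_keys_iff lookup_fscale)

interpretation poly_vec: vector_space
  "\<lambda>(c :: 'k::field) (v :: nat \<Rightarrow>\<^sub>0 ('a, 'k) mpolynomial). fscale (Poly_Mapping.single 0 c) v"
  by standard (simp_all add: fmod.scale_right_distrib fmod.scale_left_distrib single_add mult_single)

lemma lookup_fscale_single_0:
  "Poly_Mapping.lookup (Poly_Mapping.lookup (fscale (Poly_Mapping.single 0 c) v) b) m =
    c * Poly_Mapping.lookup (Poly_Mapping.lookup v b) m"
  by (simp add: lookup_fscale flip: mult_map_scale_conv_mult) (simp add: Poly_Mapping.map.rep_eq when_def)

text \<open>Only finitely many generators lie in degrees up to \<open>j\<close>, and there are only finitely many monomials
of each degree.  So the graded pieces are finite-dimensional over the ground field, which is all the
finiteness that the construction of a resolution needs.\<close>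

lemma graded_part_subset_span:
  fixes B :: "nat set"
  assumes fin: "\<And>j. finite {b \<in> B. s b = j}"
  shows "\<exists>F. finite F \<and> graded_part B s j \<subseteq> poly_vec.span (F :: (nat \<Rightarrow>\<^sub>0 ('a::finite, 'k::field) mpolynomial) set)"
proof -
  let ?X = "SIGMA b : {b \<in> B. s b \<le> j}. {m :: 'a \<Rightarrow>\<^sub>0 nat. monomial_degree m = j - s b}"
  let ?e = "\<lambda>(b, m). Poly_Mapping.single b (Poly_Mapping.single m (1 :: 'k))"
  have "{b \<in> B. s b \<le> j} = (\<Union>i\<le>j. {b \<in> B. s b = i})" by auto
  then have finX: "finite ?X"
    using fin by (intro finite_SigmaI finite_monomials_of_degree) simp
  have "graded_part B s j \<subseteq> poly_vec.span (?e ` ?X)"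
  proof
    fix v :: "nat \<Rightarrow>\<^sub>0 ('a, 'k) mpolynomial" assume v: "v \<in> graded_part B s j"
    let ?c = "\<lambda>(b, m). Poly_Mapping.lookup (Poly_Mapping.lookup v b) m"
    have "v = (\<Sum>x\<in>?X. fscale (Poly_Mapping.single 0 (?c x)) (?e x))"
    proof (rule poly_mapping_eqI, rule poly_mapping_eqI)
      fix b m
      have "Poly_Mapping.lookup (Poly_Mapping.lookup (\<Sum>x\<in>?X. fscale (Poly_Mapping.single 0 (?c x)) (?e x)) b) m =
          (\<Sum>x\<in>?X. if x = (b, m) then ?c (b, m) else 0)"
        unfolding lookup_sum
      proof (rule sum.cong[OF refl])
        fix x :: "nat \<times> ('a \<Rightarrow>\<^sub>0 nat)"
        obtain b' m' where x: "x = (b', m')" by force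
        show "Poly_Mapping.lookup (Poly_Mapping.lookup (fscale (Poly_Mapping.single 0 (?c x)) (?e x)) b) m =
            (if x = (b, m) then ?c (b, m) else 0)"
          unfolding x lookup_fscale_single_0 by (cases "b' = b"; cases "m' = m") (simp_all add: lookup_single)
      qed
      also have "\<dots> = (if (b, m) \<in> ?X then ?c (b, m) else 0)"
        by (rule sum.delta) (rule finX)
      also have "\<dots> = ?c (b, m)"
      proof (cases "?c (b, m) = 0")
        case False
        then have "s b \<le> j" "monomial_degree m = j - s b" using graded_partD[OF v, of b m] by auto
        moreover from False have "b \<in> Poly_Mapping.keys v" by (auto simp: in_keys_iff)
        then have "b \<in> B" using v by (auto simp: graded_part_def)
        ultimately show ?thesis using \<open>s b \<le> j\<close> by simp
      qed simp
      finally show "Poly_Mapping.lookup (Poly_Mapping.lookup v b) m = Poly_Mapping.lookup (Poly_Mapping.lookup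
        (\<Sum>x\<in>?X. fscale (Poly_Mapping.single 0 (?c x)) (?e x)) b) m" unfolding prod.case by (rule sym)
    qed
    also have "\<dots> \<in> poly_vec.span (?e ` ?X)"
    proof (rule poly_vec.span_sum)
      fix x assume "x \<in> ?X"
      then have "?e x \<in> poly_vec.span (?e ` ?X)" by (rule poly_vec.span_base[OF imageI])
      then show "fscale (Poly_Mapping.single 0 (?c x)) (?e x) \<in> poly_vec.span (?e ` ?X)"
        by (rule poly_vec.span_scale)
    qed
    finally show "v \<in> poly_vec.span (?e ` ?X)" .
  qed
  with finX show ?thesis by (intro exI[of _ "?e ` ?X"] conjI) (rule finite_imageI)
qed

definition linear_extension ::
    "(nat \<Rightarrow> (nat \<Rightarrow>\<^sub>0 'r::comm_ring_1)) \<Rightarrow> (nat \<Rightarrow>\<^sub>0 'r) \<Rightarrow> (nat \<Rightarrow>\<^sub>0 'r)" where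
  "linear_extension g v = (\<Sum>n\<in>Poly_Mapping.keys v. fscale (Poly_Mapping.lookup v n) (g n))"

lemma linear_extension_superset:
  assumes "finite X" "Poly_Mapping.keys v \<subseteq> X"
  shows "linear_extension g v = (\<Sum>n\<in>X. fscale (Poly_Mapping.lookup v n) (g n))"
  unfolding linear_extension_def
  by (rule sum.mono_neutral_left) (use assms in \<open>auto simp: in_keys_iff\<close>)

lemma linear_extension_single: "linear_extension g (Poly_Mapping.single n c) = fscale c (g n)"
  by (subst linear_extension_superset[of "{n}"]) auto

lemma module_hom_linear_extension: "module_hom fscale fscale (linear_extension g)"
proof -
  have add: "linear_extension g (v + w) = linear_extension g v + linear_extension g w" for v w
  proof -
    let ?X = "Poly_Mapping.keys v \<union> Poly_Mapping.keys w"
    have "linear_extension g (v + w) = (\<Sum>n\<in>?X. fscale (Poly_Mapping.lookup (v + w) n) (g n))"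
      by (rule linear_extension_superset) (use Poly_Mapping.keys_add[of v w] in auto)
    also have "\<dots> = linear_extension g v + linear_extension g w"
      by (simp add: linear_extension_superset[of ?X] lookup_add fmod.scale_left_distrib sum.distrib)
    finally show ?thesis .
  qed
  have scale: "linear_extension g (fscale c v) = fscale c (linear_extension g v)" for c v
    by (subst linear_extension_superset[of "Poly_Mapping.keys v"])
      (auto simp: keys_fscale[THEN subsetD] linear_extension_def lookup_fscale fmod.scale_sum_right)
  show ?thesis
    by (simp add: module_hom_iff add scale fmod.module_axioms)
qed

lemma subspace_keys: "fmod.subspace {v :: 'b \<Rightarrow>\<^sub>0 'r::comm_ring_1. Poly_Mapping.keys v \<subseteq> B}"
  unfolding fmod.subspace_def
proof (intro conjI ballI allI)
  fix v w :: "'b \<Rightarrow>\<^sub>0 'r" and c :: 'r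
  assume v: "v \<in> {v. Poly_Mapping.keys v \<subseteq> B}"
  show "fscale c v \<in> {v. Poly_Mapping.keys v \<subseteq> B}"
    using keys_fscale[of c v] v by auto
  assume "w \<in> {v. Poly_Mapping.keys v \<subseteq> B}"
  then show "v + w \<in> {v. Poly_Mapping.keys v \<subseteq> B}"
    using Poly_Mapping.keys_add[of v w] v by auto
qed simp

text \<open>A graded submodule \<open>Z\<close> is generated by its homogeneous elements.  In each degree \<open>j\<close> a basis of
\<open>Z\<close> in that degree over the ground field is finite, and is taken as the set of generators of degree
\<open>j\<close>.  The \<open>k\<close>-th of them has the index \<open>prod_encode (j, k)\<close>, which makes the indices disjoint for
different degrees.\<close>

lemma graded_generators:
  fixes Z :: "(nat \<Rightarrow>\<^sub>0 ('a::finite, 'k::field) mpolynomial) set"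
  assumes fin: "\<And>j. finite {b \<in> B. s b = j}"
    and sub: "fmod.subspace Z" and Z: "Z \<subseteq> {v. Poly_Mapping.keys v \<subseteq> B}"
    and graded: "\<And>v j. v \<in> Z \<Longrightarrow> degree_component s j v \<in> Z"
  shows "\<exists>B' s' d. (\<forall>j. finite {b \<in> B'. s' b = j}) \<and> module_hom fscale fscale d \<and>
      (\<forall>j. d ` graded_part B' s' j \<subseteq> graded_part B s j) \<and> d ` {v. Poly_Mapping.keys v \<subseteq> B'} = Z"
proof -
  have "\<exists>gs. set gs \<subseteq> Z \<inter> graded_part B s j \<and> Z \<inter> graded_part B s j \<subseteq> poly_vec.span (set gs)" for j
  proof -
    obtain F :: "(nat \<Rightarrow>\<^sub>0 ('a, 'k) mpolynomial) set" where F: "finite F" "graded_part B s j \<subseteq> poly_vec.span F"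
      using graded_part_subset_span[OF fin] by blast
    obtain G where G: "G \<subseteq> Z \<inter> graded_part B s j" "poly_vec.independent G"
        "Z \<inter> graded_part B s j \<subseteq> poly_vec.span G"
      using poly_vec.maximal_independent_subset by blast
    have "finite G"
      using poly_vec.independent_span_bound[OF F(1) G(2)] G(1) F(2) by blast
    then obtain xs where "set xs = G" using finite_list by blast
    then show ?thesis using G by blast
  qed
  then obtain gs where gs: "\<And>j. set (gs j) \<subseteq> Z \<inter> graded_part B s j"
      "\<And>j. Z \<inter> graded_part B s j \<subseteq> poly_vec.span (set (gs j))"
    by metis
  define s' where "s' n = fst (prod_decode n)" for n
  define B' where "B' = {n. snd (prod_decode n) < length (gs (s' n))}"
  define g where "g n = gs (s' n) ! snd (prod_decode n)" for n
  define d where "d = linear_extension g"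
  have hom: "module_hom fscale fscale d"
    unfolding d_def by (rule module_hom_linear_extension)
  interpret d: module_hom fscale fscale d by (rule hom)
  have g_in: "g n \<in> Z" "g n \<in> graded_part B s (s' n)" if "n \<in> B'" for n
    using that gs(1)[of "s' n"] by (auto simp: B'_def g_def)
  have fin': "finite {b \<in> B'. s' b = j}" for j
  proof (rule finite_subset)
    show "{b \<in> B'. s' b = j} \<subseteq> (\<lambda>k. prod_encode (j, k)) ` {..<length (gs j)}"
      by (auto simp: B'_def s'_def image_iff) (metis lessThan_iff prod.collapse prod_decode_inverse)
  qed simp
  have d_Z: "d v \<in> Z" if "Poly_Mapping.keys v \<subseteq> B'" for v
    unfolding d_def linear_extension_def
    by (intro fmod.subspace_sum[OF sub] fmod.subspace_scale[OF sub] g_in) (use that in auto)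
  have d_graded: "d v \<in> graded_part B s j" if v: "v \<in> graded_part B' s' j" for v j
  proof (rule graded_partI)
    have keys: "Poly_Mapping.keys v \<subseteq> B'" using v by (auto simp: graded_part_def)
    then show "Poly_Mapping.keys (d v) \<subseteq> B" using d_Z Z by blast
    fix b m assume "Poly_Mapping.lookup (Poly_Mapping.lookup (d v) b) m \<noteq> 0"
    then obtain n where n: "n \<in> Poly_Mapping.keys v"
        "Poly_Mapping.lookup (Poly_Mapping.lookup v n * Poly_Mapping.lookup (g n) b) m \<noteq> 0"
      by (auto simp: d_def linear_extension_def lookup_sum lookup_fscale elim!: sum.not_neutral_contains_not_neutral)
    then have "m \<in> Poly_Mapping.keys (Poly_Mapping.lookup v n * Poly_Mapping.lookup (g n) b)"
      by (simp add: in_keys_iff)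
    then obtain p q where "m = p + q" "p \<in> Poly_Mapping.keys (Poly_Mapping.lookup v n)"
        "q \<in> Poly_Mapping.keys (Poly_Mapping.lookup (g n) b)"
      using keys_mult by blast
    moreover from this have "monomial_degree p + s' n = j" "monomial_degree q + s b = s' n"
      using graded_partD[OF v, of n p] graded_partD[OF g_in(2), of n b q] n keys by (auto simp: in_keys_iff)
    ultimately show "monomial_degree m + s b = j" by simp
  qed
  have "Z \<subseteq> d ` {v. Poly_Mapping.keys v \<subseteq> B'}"
  proof
    fix v assume v: "v \<in> Z"
    let ?im = "d ` {v. Poly_Mapping.keys v \<subseteq> B'}"
    have sub': "fmod.subspace ?im" by (intro d.subspace_image subspace_keys)
    have "g n \<in> ?im" if "n \<in> B'" for n
      using that by (intro rev_image_eqI[of "Poly_Mapping.single n 1"]) (auto simp: d_def linear_extension_single)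
    then have gens: "set (gs j) \<subseteq> ?im" for j
    proof -
      have "x \<in> ?im" if "x \<in> set (gs j)" for x
      proof -
        obtain k where "k < length (gs j)" "x = gs j ! k" using \<open>x \<in> set (gs j)\<close> by (metis in_set_conv_nth)
        then have "prod_encode (j, k) \<in> B'" "g (prod_encode (j, k)) = x"
          by (auto simp: B'_def s'_def g_def)
        then show ?thesis using \<open>\<And>n. n \<in> B' \<Longrightarrow> g n \<in> ?im\<close> by blast
      qed
      then show ?thesis by blast
    qed
    have "poly_vec.subspace ?im"
      unfolding poly_vec.subspace_def
      by (intro conjI ballI allI fmod.subspace_0[OF sub'] fmod.subspace_add[OF sub'] fmod.subspace_scale[OF sub'])
    then have span: "poly_vec.span (set (gs j)) \<subseteq> ?im" for j
      using gens by (rule poly_vec.span_minimal[rotated])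
    have im: "degree_component s j v \<in> ?im" for j
    proof -
      have "Poly_Mapping.keys v \<subseteq> B" using v Z by blast
      then have "degree_component s j v \<in> Z \<inter> graded_part B s j"
        using graded[OF v] degree_component_in_graded_part by blast
      then show ?thesis using gs(2)[of j] span[of j] by (meson subsetD)
    qed
    obtain J where J: "v = (\<Sum>j\<in>J. degree_component s j v)"
      using degree_decomposition[of v s] by blast
    have "(\<Sum>j\<in>J. degree_component s j v) \<in> ?im"
      by (rule fmod.subspace_sum[OF sub']) (rule im)
    then show "v \<in> ?im" by (simp only: J[symmetric])
  qed
  moreover have "d ` {v. Poly_Mapping.keys v \<subseteq> B'} \<subseteq> Z" using d_Z by blast
  ultimately have "d ` {v. Poly_Mapping.keys v \<subseteq> B'} = Z" by (rule equalityI[rotated])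
  moreover have "d ` graded_part B' s' j \<subseteq> graded_part B s j" for j using d_graded by blast
  ultimately show ?thesis using fin' hom by blast
qed

text \<open>Decompose \<open>v\<close> into homogeneous components; a map that preserves degrees sends the component of
degree \<open>i\<close> into degree \<open>i\<close>, so only the one of degree \<open>j\<close> contributes.\<close>

lemma module_hom_degree_component:
  fixes d :: "(nat \<Rightarrow>\<^sub>0 ('a, 'k::comm_ring_1) mpolynomial) \<Rightarrow> (nat \<Rightarrow>\<^sub>0 ('a, 'k) mpolynomial)"
  assumes hom: "module_hom fscale fscale d"
    and graded: "\<And>j. d ` graded_part B' s' j \<subseteq> graded_part B s j"
    and v: "Poly_Mapping.keys v \<subseteq> B'"
  shows "d (degree_component s' j v) = degree_component s j (d v)"
proof -
  interpret d: module_hom fscale fscale d by (rule hom)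
  obtain J where J: "finite J" "v = (\<Sum>i\<in>J. degree_component s' i v)"
    using degree_decomposition by blast
  let ?v = "\<lambda>i. degree_component s' i v"
  have vi: "?v i \<in> graded_part B' s' i" for i
    using v by (rule degree_component_in_graded_part)
  then have dvi: "d (?v i) \<in> graded_part B s i" for i
    using graded by blast
  have "?v j = (\<Sum>i\<in>J. degree_component s' j (?v i))"
    by (subst (1) J(2)) (rule degree_component_sum)
  also have "\<dots> = (\<Sum>i\<in>J. if i = j then ?v j else 0)"
    by (rule sum.cong) (auto simp: degree_component_graded[OF vi])
  also have "\<dots> = (if j \<in> J then ?v j else 0)"
    by (rule sum.delta[OF J(1)])
  finally have vj: "?v j = (if j \<in> J then ?v j else 0)" .
  have "?v j = 0" if "j \<notin> J"
    by (rule trans[OF vj if_not_P[OF that]])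
  then have "d (?v j) = (if j \<in> J then d (?v j) else 0)"
    by (cases "j \<in> J") (simp_all add: d.zero)
  also have "\<dots> = (\<Sum>i\<in>J. if i = j then d (?v j) else 0)"
    by (rule sum.delta[OF J(1), symmetric])
  also have "\<dots> = (\<Sum>i\<in>J. degree_component s j (d (?v i)))"
    by (rule sum.cong) (auto simp: degree_component_graded[OF dvi])
  also have "\<dots> = degree_component s j (d (\<Sum>i\<in>J. ?v i))"
    by (simp only: degree_component_sum d.sum)
  finally show ?thesis by (simp only: J(2)[symmetric])
qed

interpretation ring_mod: module "(*) :: 'r::comm_ring_1 \<Rightarrow> 'r \<Rightarrow> 'r"
  by standard (simp_all add: algebra_simps)

text \<open>For multiplication as the scalar action this rewrite rule reassociates products to the left, and
so loops together with the usual associativity rule.\<close>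

declare ring_mod.scale_scale [simp del]

text \<open>Start with \<open>I\<close>, as a submodule of the free module on one generator of degree \<open>0\<close>, cover it by a free
module, pass to the kernel and repeat.  A state consists of the generators of the last free module,
their degrees and the submodule that the next map has to cover; \<open>good\<close> is the invariant that makes
\<open>graded_generators\<close> applicable to it.\<close>

lemma graded_free_resolution_exists:
  fixes I :: "('a::finite, 'k::field) mpolynomial set"
  assumes ideal: "ring_mod.subspace I"
    and homogeneous: "\<And>f j. f \<in> I \<Longrightarrow> filter_keys (\<lambda>m. monomial_degree m = j) f \<in> I"
  shows "\<exists>C. graded_free_resolution I C"
proof -
  define Z0 :: "(nat \<Rightarrow>\<^sub>0 ('a, 'k) mpolynomial) set"
    where "Z0 = {v. Poly_Mapping.keys v \<subseteq> {0} \<and> Poly_Mapping.lookup v 0 \<in> I}"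
  define good where "good = (\<lambda>(B :: nat set, s :: nat \<Rightarrow> nat, Z :: (nat \<Rightarrow>\<^sub>0 ('a, 'k) mpolynomial) set).
    (\<forall>j. finite {b \<in> B. s b = j}) \<and> fmod.subspace Z \<and> Z \<subseteq> {v. Poly_Mapping.keys v \<subseteq> B} \<and>
    (\<forall>v\<in>Z. \<forall>j. degree_component s j v \<in> Z))"
  define step where "step = (\<lambda>(B, s, Z) (B', s', Z' :: (nat \<Rightarrow>\<^sub>0 ('a, 'k) mpolynomial) set) d.
    module_hom fscale fscale d \<and> (\<forall>j. d ` graded_part B' s' j \<subseteq> graded_part B s j) \<and>
    d ` {v. Poly_Mapping.keys v \<subseteq> B'} = Z \<and> Z' = {v. Poly_Mapping.keys v \<subseteq> B' \<and> d v = 0})"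
  have good0: "good ({0}, \<lambda>_. 0, Z0)"
  proof -
    have "fmod.subspace Z0"
      unfolding fmod.subspace_def
    proof (intro conjI ballI allI)
      show "0 \<in> Z0" by (simp add: Z0_def ring_mod.subspace_0[OF ideal])
      fix v w c assume v: "v \<in> Z0"
      show "fscale c v \<in> Z0"
        using v keys_fscale[of c v] by (auto simp: Z0_def lookup_fscale ring_mod.subspace_scale[OF ideal])
      assume w: "w \<in> Z0"
      show "v + w \<in> Z0"
        using v w Poly_Mapping.keys_add[of v w] by (auto simp: Z0_def lookup_add ring_mod.subspace_add[OF ideal])
    qed
    moreover have "degree_component (\<lambda>_. 0) j v \<in> Z0" if "v \<in> Z0" for v j
      using that keys_degree_component[of "\<lambda>_. 0" j v] homogeneous
      by (auto simp: Z0_def lookup_degree_component)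
    moreover have "Z0 \<subseteq> {v. Poly_Mapping.keys v \<subseteq> {0}}" by (auto simp: Z0_def)
    ultimately show ?thesis by (simp add: good_def)
  qed
  have next_step: "\<exists>Y d. good Y \<and> step X Y d" if "good X" for X
  proof -
    obtain B s Z where X: "X = (B, s, Z)" by (cases X)
    have good: "\<And>j. finite {b \<in> B. s b = j}" "fmod.subspace Z" "Z \<subseteq> {v. Poly_Mapping.keys v \<subseteq> B}"
        "\<And>v j. v \<in> Z \<Longrightarrow> degree_component s j v \<in> Z"
      using that unfolding X good_def by auto
    obtain B' s' d where d: "\<forall>j. finite {b \<in> B'. s' b = j}" "module_hom fscale fscale d"
        "\<forall>j. d ` graded_part B' s' j \<subseteq> graded_part B s j" "d ` {v. Poly_Mapping.keys v \<subseteq> B'} = Z"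
      using graded_generators[OF good] by blast
    interpret d: module_hom fscale fscale d by (rule d(2))
    define Z' where "Z' = {v. Poly_Mapping.keys v \<subseteq> B' \<and> d v = 0}"
    have "fmod.subspace Z'"
    proof -
      have "Z' = {v. Poly_Mapping.keys v \<subseteq> B'} \<inter> {v. d v = 0}" by (auto simp: Z'_def)
      then show ?thesis
        by (simp only:) (intro fmod.subspace_inter subspace_keys d.subspace_kernel)
    qed
    moreover have "degree_component s' j v \<in> Z'" if "v \<in> Z'" for v j
      using that keys_degree_component[of s' j v] module_hom_degree_component[of d B' s' B s v j] d(2,3)
      by (auto simp: Z'_def)
    moreover have "Z' \<subseteq> {v. Poly_Mapping.keys v \<subseteq> B'}" by (auto simp: Z'_def)
    ultimately have "good (B', s', Z')" using d(1) by (simp add: good_def)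
    moreover have "step X (B', s', Z') d" using d(2-4) by (simp add: step_def X Z'_def)
    ultimately show ?thesis by blast
  qed
  have "\<exists>F. \<forall>n. (good (F n) \<and> (n = 0 \<longrightarrow> F n = ({0}, \<lambda>_. 0, Z0))) \<and> (\<exists>d. step (F n) (F (Suc n)) d)"
  proof (rule dependent_nat_choice)
    show "\<exists>X. good X \<and> ((0 :: nat) = 0 \<longrightarrow> X = ({0}, \<lambda>_. 0, Z0))"
      using good0 by blast
    fix X and n :: nat
    assume "good X \<and> (n = 0 \<longrightarrow> X = ({0}, \<lambda>_. 0, Z0))"
    then show "\<exists>Y. (good Y \<and> (Suc n = 0 \<longrightarrow> Y = ({0}, \<lambda>_. 0, Z0))) \<and> (\<exists>d. step X Y d)"
      using next_step[of X] by auto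
  qed
  then obtain F where F: "\<And>n. good (F n)" "F 0 = ({0}, \<lambda>_. 0, Z0)" and "\<And>n. \<exists>d. step (F n) (F (Suc n)) d"
    by blast
  then obtain D where D: "\<And>n. step (F n) (F (Suc n)) (D n)" by metis
  define C where "C = \<lparr>basis = (\<lambda>i. fst (F i)), shift = (\<lambda>i. fst (snd (F i))), diff = D\<rparr>"
  let ?Z = "\<lambda>i. snd (snd (F i))"
  have C: "basis C i = fst (F i)" "shift C i = fst (snd (F i))" "diff C i = D i" for i
    by (simp_all add: C_def)
  have fin: "finite {b \<in> basis C i. shift C i b = j}" for i j
    using F(1)[of i] by (auto simp: good_def C split: prod.splits)
  have steps: "module_hom fscale fscale (diff C i)"
      "diff C i ` free_graded_part C (Suc i) j \<subseteq> free_graded_part C i j"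
      "diff C i ` free_part C (Suc i) = ?Z i" "?Z (Suc i) = {v \<in> free_part C (Suc i). diff C i v = 0}" for i j
    using D[of i] unfolding step_def free_graded_part_eq free_part_def C by (auto split: prod.splits)
  let ?eps = "\<lambda>v :: nat \<Rightarrow>\<^sub>0 ('a, 'k) mpolynomial. Poly_Mapping.lookup v 0"
  have "graded_free_resolution I C"
    unfolding graded_free_resolution_def
  proof (intro conjI allI exI[of _ ?eps])
    show "finite {b \<in> basis C i. shift C i b = j}" for i j by (rule fin)
    show "module_hom fscale fscale (diff C i)" for i by (rule steps)
    show "diff C i ` free_graded_part C (Suc i) j \<subseteq> free_graded_part C i j" for i j by (rule steps)
    show "{v \<in> free_part C (Suc i). diff C i v = 0} = diff C (Suc i) ` free_part C (Suc (Suc i))" for i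
      by (simp only: steps(3,4))
    show "module_hom fscale (*) ?eps"
      by (simp add: module_hom_iff fmod.module_axioms ring_mod.module_axioms lookup_add lookup_fscale)
    show "?eps ` free_graded_part C 0 j \<subseteq> homogeneous_part j" for j
    proof -
      have "?eps v \<in> homogeneous_part j" if "v \<in> graded_part {0} (\<lambda>_. 0) j" for v
        using graded_partD[OF that] by (auto simp: homogeneous_part_def in_keys_iff)
      then show ?thesis unfolding free_graded_part_eq C F(2) by auto
    qed
    show "\<exists>v\<in>free_part C 0. f - ?eps v \<in> I" for f
      by (rule bexI[of _ "Poly_Mapping.single 0 f"])
        (simp_all add: ring_mod.subspace_0[OF ideal] free_part_def C F(2))
    show "{v \<in> free_part C 0. ?eps v \<in> I} = diff C 0 ` free_part C (Suc 0)"
      unfolding steps(3) by (simp add: F(2) Z0_def free_part_def C)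
  qed
  then show ?thesis by blast
qed

section \<open>The Koszul complex\<close>

lemma sum_single_lookup: "p = (\<Sum>n\<in>Poly_Mapping.keys p. Poly_Mapping.single n (Poly_Mapping.lookup p n))"
proof (rule poly_mapping_eqI)
  fix m
  have "Poly_Mapping.lookup (\<Sum>n\<in>Poly_Mapping.keys p. Poly_Mapping.single n (Poly_Mapping.lookup p n)) m =
      (\<Sum>n\<in>Poly_Mapping.keys p. if n = m then Poly_Mapping.lookup p n else 0)"
    unfolding lookup_sum lookup_single when_def ..
  also have "\<dots> = Poly_Mapping.lookup p m"
    by (simp add: in_keys_iff)
  finally show "Poly_Mapping.lookup p m =
    Poly_Mapping.lookup (\<Sum>n\<in>Poly_Mapping.keys p. Poly_Mapping.single n (Poly_Mapping.lookup p n)) m" ..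
qed

lemma single_mult_eq_sum:
  fixes p :: "'b::cancel_comm_monoid_add \<Rightarrow>\<^sub>0 'r::comm_semiring_1"
  shows "Poly_Mapping.single t c * p =
    (\<Sum>n\<in>Poly_Mapping.keys p. Poly_Mapping.single (t + n) (c * Poly_Mapping.lookup p n))"
  by (subst (1) sum_single_lookup[of p]) (simp only: sum_distrib_left mult_single)

lemma lookup_single_mult:
  fixes p :: "'b::cancel_comm_monoid_add \<Rightarrow>\<^sub>0 'r::comm_semiring_1"
  shows "Poly_Mapping.lookup (Poly_Mapping.single t c * p) m =
    (\<Sum>n\<in>Poly_Mapping.keys p. if t + n = m then c * Poly_Mapping.lookup p n else 0)"
  by (simp only: single_mult_eq_sum lookup_sum lookup_single when_def)

lemma lookup_single_mult_add:
  fixes p :: "'b::cancel_comm_monoid_add \<Rightarrow>\<^sub>0 'r::comm_semiring_1"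
  shows "Poly_Mapping.lookup (Poly_Mapping.single t c * p) (t + n) = c * Poly_Mapping.lookup p n"
  by (simp add: lookup_single_mult in_keys_iff)

lemma lookup_const_mult:
  fixes p :: "'b::cancel_comm_monoid_add \<Rightarrow>\<^sub>0 'r::comm_semiring_1"
  shows "Poly_Mapping.lookup (Poly_Mapping.single 0 c * p) m = c * Poly_Mapping.lookup p m"
  using lookup_single_mult_add[of 0 c p m] by simp

lemma lookup_var_mult:
  "Poly_Mapping.lookup (var a * p) m =
    (if a \<in> Poly_Mapping.keys m then Poly_Mapping.lookup p (m - Poly_Mapping.single a 1) else 0)"
proof (cases "a \<in> Poly_Mapping.keys m")
  case True
  then have "m = Poly_Mapping.single a 1 + (m - Poly_Mapping.single a 1)"
    by (intro poly_mapping_eqI) (auto simp: lookup_add lookup_minus lookup_single when_def in_keys_iff)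
  then have "Poly_Mapping.lookup (var a * p) m =
      Poly_Mapping.lookup (var a * p) (Poly_Mapping.single a 1 + (m - Poly_Mapping.single a 1))" by simp
  also have "\<dots> = Poly_Mapping.lookup p (m - Poly_Mapping.single a 1)"
    unfolding var_def lookup_single_mult_add by simp
  finally show ?thesis using True by simp
next
  case False
  then have "Poly_Mapping.single a 1 + n \<noteq> m" for n
    by (auto simp: in_keys_iff lookup_add)
  then show ?thesis using False by (simp add: var_def lookup_single_mult)
qed

text \<open>A linear order of the variables, used for the signs in the exterior algebra and to select the
variable in the contracting homotopy.\<close>

locale variable_order =
  fixes idx :: "'a::finite \<Rightarrow> nat"
  assumes inj_idx: "inj idx"
begin

text \<open>The sign with which $e_a \wedge e_A$ becomes $e_{A \cup \{a\}}$, for $a \notin A$, where $e_A$ is the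
exterior product of the elements of $A$ in increasing order.\<close>

definition koszul_sign :: "'a \<Rightarrow> 'a set \<Rightarrow> 'r::comm_ring_1" where
  "koszul_sign a A = (-1) ^ card {b \<in> A. idx b < idx a}"

lemma koszul_sign_eq_single:
  "koszul_sign a A = (Poly_Mapping.single 0 (koszul_sign a A) :: ('a, 'k::comm_ring_1) mpolynomial)"
proof -
  have "(-1 :: ('a, 'k) mpolynomial) ^ n = Poly_Mapping.single 0 ((-1) ^ n)" for n
  proof (induction n)
    case (Suc n)
    have "(-1 :: ('a, 'k) mpolynomial) = Poly_Mapping.single 0 (-1)"
      by (simp add: single_uminus)
    then show ?case using Suc by (simp add: mult_single del: single_uminus)
  qed simp
  then show ?thesis by (simp only: koszul_sign_def)
qed

lemma koszul_sign_square: "koszul_sign a A * koszul_sign a A = 1"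
  by (simp add: koszul_sign_def flip: power_add mult_2)

lemma koszul_sign_least: "(\<And>b. b \<in> A \<Longrightarrow> idx a \<le> idx b) \<Longrightarrow> koszul_sign a A = 1"
proof -
  assume "\<And>b. b \<in> A \<Longrightarrow> idx a \<le> idx b"
  then have empty: "{b \<in> A. idx b < idx a} = {}" by force
  show ?thesis unfolding koszul_sign_def empty by simp
qed

lemma koszul_sign_insert_below:
  assumes "b \<notin> A" "idx b < idx a"
  shows "koszul_sign a (insert b A) = - koszul_sign a A"
proof -
  have "{c \<in> insert b A. idx c < idx a} = insert b {c \<in> A. idx c < idx a}"
    using assms by auto
  then show ?thesis using assms by (simp add: koszul_sign_def)
qed

lemma koszul_sign_insert_above:
  assumes "idx a \<le> idx b"
  shows "koszul_sign a (insert b A) = koszul_sign a A"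
proof -
  have "{c \<in> insert b A. idx c < idx a} = {c \<in> A. idx c < idx a}"
    using assms by auto
  then show ?thesis by (simp add: koszul_sign_def)
qed

lemma koszul_sign_swap:
  assumes "a \<notin> A" "b \<notin> A" "a \<noteq> b"
  shows "koszul_sign b A * koszul_sign a (insert b A) = - (koszul_sign a A * koszul_sign b (insert a A))"
proof -
  have "idx a < idx b \<or> idx b < idx a"
    using assms(3) inj_idx by (metis injD linorder_neqE_nat)
  then show ?thesis
    using assms by (auto simp: koszul_sign_insert_below koszul_sign_insert_above)
qed

text \<open>A chain $\sum_A f_A e_A$ of the Koszul complex with coefficients in a module is represented by the
function \<open>f\<close> of its coefficients.  All Koszul degrees are treated together; a chain of degree \<open>q\<close>
vanishes on the sets whose cardinality is not \<open>q\<close>.\<close>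

definition koszul_diff ::
    "(('a, 'k::comm_ring_1) mpolynomial \<Rightarrow> 'm \<Rightarrow> 'm::ab_group_add) \<Rightarrow> ('a set \<Rightarrow> 'm) \<Rightarrow> 'a set \<Rightarrow> 'm" where
  "koszul_diff scale f A = (\<Sum>a\<in>-A. scale (koszul_sign a A * var a) (f (insert a A)))"

lemma koszul_diff_minus:
  assumes "module scale"
  shows "koszul_diff scale (\<lambda>A. f A - g A) A = koszul_diff scale f A - koszul_diff scale g A"
proof -
  interpret module scale by (rule assms)
  show ?thesis by (simp add: koszul_diff_def scale_right_diff_distrib sum_subtractf)
qed

lemma koszul_diff_hom:
  assumes "module_hom s1 s2 h"
  shows "h (koszul_diff s1 f A) = koszul_diff s2 (\<lambda>A. h (f A)) A"
proof -
  interpret module_hom s1 s2 h by (rule assms)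
  show ?thesis by (simp add: koszul_diff_def sum scale)
qed

lemma koszul_diff_subspace:
  assumes "module scale" "module.subspace scale V" "\<And>A. f A \<in> V"
  shows "koszul_diff scale f A \<in> V"
proof -
  interpret module scale by (rule assms)
  show ?thesis unfolding koszul_diff_def
    by (intro subspace_sum[OF assms(2)] subspace_scale[OF assms(2)] assms(3))
qed

text \<open>The contributions of $(a, b)$ and $(b, a)$ cancel.  The pairs are divided according to which
component is smaller, so that the argument is valid in characteristic two.\<close>

lemma koszul_diff_koszul_diff:
  assumes "module scale"
  shows "koszul_diff scale (koszul_diff scale f) A = 0"
proof -
  interpret module scale by (rule assms)
  let ?F = "\<lambda>a b. scale (koszul_sign a A * var a * (koszul_sign b (insert a A) * var b)) (f (insert b (insert a A)))"
  let ?G = "\<lambda>P. \<Sum>(a, b)\<in>{(a, b). a \<notin> A \<and> b \<notin> A \<and> P a b}. ?F a b"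
  have "koszul_diff scale (koszul_diff scale f) A = (\<Sum>a\<in>-A. \<Sum>b\<in>-insert a A. ?F a b)"
    unfolding koszul_diff_def scale_sum_right scale_scale ..
  also have "\<dots> = (\<Sum>(a, b)\<in>(SIGMA a:-A. - insert a A). ?F a b)"
    by (rule sum.Sigma) simp_all
  also have "(SIGMA a:-A. - insert a A) =
      {(a, b). a \<notin> A \<and> b \<notin> A \<and> idx a < idx b} \<union> {(a, b). a \<notin> A \<and> b \<notin> A \<and> idx b < idx a}"
    using inj_idx by (auto dest: injD) (metis injD linorder_neqE_nat)
  also have "(\<Sum>(a, b)\<in>\<dots>. ?F a b) = ?G (\<lambda>a b. idx a < idx b) + ?G (\<lambda>a b. idx b < idx a)"
    by (rule sum.union_disjoint) auto
  also have "?G (\<lambda>a b. idx b < idx a) =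
      (\<Sum>(a, b)\<in>{(a, b). a \<notin> A \<and> b \<notin> A \<and> idx a < idx b}. ?F b a)"
    by (rule sum.reindex_bij_witness[where i = prod.swap and j = prod.swap]) auto
  also have "\<dots> = - ?G (\<lambda>a b. idx a < idx b)"
    unfolding sum_negf[symmetric]
  proof (rule sum.cong[OF refl], clarify)
    fix a b assume ab: "a \<notin> A" "b \<notin> A" "idx a < idx b"
    then have swap: "koszul_sign b A * koszul_sign a (insert b A) =
        - (koszul_sign a A * koszul_sign b (insert a A) :: ('a, 'b) mpolynomial)"
      by (intro koszul_sign_swap) auto
    have "koszul_sign b A * var b * (koszul_sign a (insert b A) * var a) =
        (koszul_sign b A * koszul_sign a (insert b A)) * (var a * var b :: ('a, 'b) mpolynomial)"
      by (simp only: ac_simps)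
    also have "\<dots> = - (koszul_sign a A * var a * (koszul_sign b (insert a A) * var b))"
      unfolding swap by (simp only: ac_simps mult_minus_right)
    finally show "?F b a = - ?F a b"
      by (simp only: scale_minus_left insert_commute)
  qed
  finally show ?thesis by simp
qed

subsection \<open>Exactness over free modules\<close>

text \<open>Division by $v$ of those terms in which $v$ occurs and is the least variable.\<close>

definition divide_least :: "'a \<Rightarrow> ('a, 'k::zero) mpolynomial \<Rightarrow> ('a, 'k) mpolynomial" where
  "divide_least v p = Abs_poly_mapping
     (\<lambda>m. Poly_Mapping.lookup p (m + Poly_Mapping.single v 1) when (\<forall>a\<in>Poly_Mapping.keys m. idx v \<le> idx a))"

lemma lookup_divide_least:
  "Poly_Mapping.lookup (divide_least v p) m =
    (Poly_Mapping.lookup p (m + Poly_Mapping.single v 1) when (\<forall>a\<in>Poly_Mapping.keys m. idx v \<le> idx a))"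
proof -
  have "finite ((\<lambda>m. m + Poly_Mapping.single v 1) -` Poly_Mapping.keys p)"
    by (intro finite_vimageI finite_keys injI) simp
  moreover have "{m. (Poly_Mapping.lookup p (m + Poly_Mapping.single v 1) when (\<forall>a\<in>Poly_Mapping.keys m. idx v \<le> idx a)) \<noteq> 0}
      \<subseteq> (\<lambda>m. m + Poly_Mapping.single v 1) -` Poly_Mapping.keys p"
    by (auto simp: in_keys_iff)
  ultimately have "finite {m. (Poly_Mapping.lookup p (m + Poly_Mapping.single v 1) when (\<forall>a\<in>Poly_Mapping.keys m. idx v \<le> idx a)) \<noteq> 0}"
    by (rule finite_subset[rotated])
  then show ?thesis unfolding divide_least_def by (simp only: lookup_Abs_poly_mapping)
qed

lemma divide_least_zero [simp]: "divide_least v 0 = 0"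
  by (rule poly_mapping_eqI) (simp add: lookup_divide_least)

text \<open>A contracting homotopy of the Koszul complex over a free module that works in every characteristic.
Let $v$ be the least variable that occurs in $A$ or in the monomial $m$.  The homotopy sends $m\,e_A$
to $(m/v)\,e_v \wedge e_A$ if $v \notin A$, and to $0$ otherwise.\<close>

definition koszul_contraction ::
    "('a set \<Rightarrow> (nat \<Rightarrow>\<^sub>0 ('a, 'k::zero) mpolynomial)) \<Rightarrow> 'a set \<Rightarrow> (nat \<Rightarrow>\<^sub>0 ('a, 'k) mpolynomial)" where
  "koszul_contraction f A = (if A = {} then 0 else
     Poly_Mapping.map (divide_least (arg_min_on idx A)) (f (A - {arg_min_on idx A})))"

lemma ex_least:
  assumes "A \<noteq> {}"
  obtains v where "v \<in> A" "\<And>a. a \<in> A \<Longrightarrow> idx v \<le> idx a"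
proof
  show "arg_min_on idx A \<in> A"
    using arg_min_if_finite(1)[of A idx] assms by simp
  show "idx (arg_min_on idx A) \<le> idx a" if "a \<in> A" for a
    using arg_min_if_finite(2)[of A idx] assms that by (meson finite not_le)
qed

lemma arg_min_on_idx:
  assumes "v \<in> A" "\<And>a. a \<in> A \<Longrightarrow> idx v \<le> idx a"
  shows "arg_min_on idx A = v"
proof -
  have "arg_min_on idx A \<in> A" "\<not> (\<exists>x\<in>A. idx x < idx (arg_min_on idx A))"
    using arg_min_if_finite[of A idx] assms(1) by auto
  then have "idx (arg_min_on idx A) = idx v"
    using assms by (meson le_antisym not_le)
  then show ?thesis using inj_idx by (simp add: inj_eq)
qed

lemma lookup_koszul_contraction:
  assumes "v \<in> A" "\<And>a. a \<in> A \<Longrightarrow> idx v \<le> idx a"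
  shows "Poly_Mapping.lookup (Poly_Mapping.lookup (koszul_contraction f A) b) m =
    (if \<forall>a\<in>Poly_Mapping.keys m. idx v \<le> idx a
     then Poly_Mapping.lookup (Poly_Mapping.lookup (f (A - {v})) b) (m + Poly_Mapping.single v 1) else 0)"
proof -
  have "A \<noteq> {}" using assms(1) by auto
  then show ?thesis
    by (simp add: koszul_contraction_def arg_min_on_idx[OF assms] Poly_Mapping.map.rep_eq
      lookup_divide_least when_def)
qed

lemma lookup_koszul_diff:
  fixes f :: "'a set \<Rightarrow> (nat \<Rightarrow>\<^sub>0 ('a, 'k::comm_ring_1) mpolynomial)"
  shows "Poly_Mapping.lookup (Poly_Mapping.lookup (koszul_diff fscale f A) b) m =
    (\<Sum>a\<in>-A. koszul_sign a A * (if a \<in> Poly_Mapping.keys m then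
       Poly_Mapping.lookup (Poly_Mapping.lookup (f (insert a A)) b) (m - Poly_Mapping.single a 1) else 0))"
proof -
  have sign: "koszul_sign a A * var a * p = Poly_Mapping.single 0 (koszul_sign a A) * (var a * p)"
    for a and p :: "('a, 'k) mpolynomial"
    by (simp only: koszul_sign_eq_single mult.assoc)
  show ?thesis
    unfolding koszul_diff_def lookup_sum lookup_fscale sign
    by (rule sum.cong[OF refl]) (simp only: lookup_const_mult lookup_var_mult)
qed

text \<open>The homotopy $h$ satisfies $\partial h + h \partial = \mathrm{id}$ except at the constant terms of the
coefficient of $e_\emptyset$, which are excluded by \<open>const\<close>.  The identity is checked at each term
$m\,e_A$: if the least variable $v$ is not in $A$, then only the term of $\partial h$ that belongs to
$v$ survives; if it is, then the cycle condition at $A - \{v\}$ and $mv$ expresses the coefficient by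
the others, and these are the terms of $\partial h f$ up to a sign coming from the position of $v$.\<close>

lemma koszul_exact:
  fixes f :: "'a set \<Rightarrow> (nat \<Rightarrow>\<^sub>0 ('a, 'k::comm_ring_1) mpolynomial)"
  assumes cycle: "\<And>A. koszul_diff fscale f A = 0"
    and const: "\<And>b. Poly_Mapping.lookup (Poly_Mapping.lookup (f {}) b) 0 = 0"
  shows "f A = koszul_diff fscale (koszul_contraction f) A"
proof (rule poly_mapping_eqI, rule poly_mapping_eqI)
  fix b :: nat and m :: "'a \<Rightarrow>\<^sub>0 nat"
  let ?c = "\<lambda>g A m. Poly_Mapping.lookup (Poly_Mapping.lookup (g A) b) m"
  let ?t = "\<lambda>a. koszul_sign a A * (if a \<in> Poly_Mapping.keys m
    then ?c (koszul_contraction f) (insert a A) (m - Poly_Mapping.single a 1) else 0)"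
  have "?c f A m = (\<Sum>a\<in>-A. ?t a)"
  proof (cases "A \<union> Poly_Mapping.keys m = {}")
    case True
    then show ?thesis using const by simp
  next
    case False
    then obtain v where v0: "v \<in> A \<union> Poly_Mapping.keys m" "\<And>a. a \<in> A \<union> Poly_Mapping.keys m \<Longrightarrow> idx v \<le> idx a"
      using ex_least[OF False] by blast
    then have v: "v \<in> A \<union> Poly_Mapping.keys m"
        "\<And>a. a \<in> A \<Longrightarrow> idx v \<le> idx a" "\<And>a. a \<in> Poly_Mapping.keys m \<Longrightarrow> idx v \<le> idx a"
      by auto
    have v_less: "idx v < idx a" if "a \<in> A \<union> Poly_Mapping.keys m" "a \<noteq> v" for a
      using v(2,3)[of a] that inj_idx by (metis Un_iff injD le_neq_implies_less)
    have keys_minus: "Poly_Mapping.keys (m - Poly_Mapping.single a 1) \<subseteq> Poly_Mapping.keys m" for a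
      by (auto simp: in_keys_iff lookup_minus)
    show ?thesis
    proof (cases "v \<in> A")
      case True
      let ?s = "\<lambda>a. koszul_sign a (A - {v}) * (if a \<in> Poly_Mapping.keys (m + Poly_Mapping.single v 1)
        then ?c f (insert a (A - {v})) (m + Poly_Mapping.single v 1 - Poly_Mapping.single a 1) else 0)"
      have compl: "- (A - {v}) = insert v (- A)" using True by auto
      have "0 = ?c (koszul_diff fscale f) (A - {v}) (m + Poly_Mapping.single v 1)"
        by (simp add: cycle)
      also have "\<dots> = (\<Sum>a\<in>- (A - {v}). ?s a)"
        by (rule lookup_koszul_diff)
      also have "\<dots> = ?s v + (\<Sum>a\<in>-A. ?s a)"
        unfolding compl using True by (intro sum.insert) auto
      also have "?s v = ?c f A m"
      proof -
        have "koszul_sign v (A - {v}) = (1 :: 'k)" by (rule koszul_sign_least) (use v in auto)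
        then show ?thesis using True by (simp add: insert_absorb in_keys_iff lookup_add)
      qed
      also have "(\<Sum>a\<in>-A. ?s a) = (\<Sum>a\<in>-A. - ?t a)"
      proof (rule sum.cong[OF refl])
        fix a assume a: "a \<in> - A"
        then have "a \<noteq> v" using True by auto
        show "?s a = - ?t a"
        proof (cases "a \<in> Poly_Mapping.keys m")
          case a_in: True
          then have "idx v < idx a" using v_less \<open>a \<noteq> v\<close> by auto
          then have sign: "koszul_sign a A = - (koszul_sign a (A - {v}) :: 'k)"
            using koszul_sign_insert_below[of v "A - {v}" a] True by (simp add: insert_absorb)
          have m: "m + Poly_Mapping.single v 1 - Poly_Mapping.single a 1 = m - Poly_Mapping.single a 1 + Poly_Mapping.single v 1"
            using \<open>a \<noteq> v\<close> by (intro poly_mapping_eqI) (auto simp: lookup_add lookup_minus lookup_single when_def)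
          have "?c (koszul_contraction f) (insert a A) (m - Poly_Mapping.single a 1) =
              ?c f (insert a A - {v}) (m - Poly_Mapping.single a 1 + Poly_Mapping.single v 1)"
            using v \<open>idx v < idx a\<close> True keys_minus
            by (subst lookup_koszul_contraction[where v = v]) auto
          moreover have "insert a A - {v} = insert a (A - {v})" using \<open>a \<noteq> v\<close> by auto
          moreover have "a \<in> Poly_Mapping.keys (m + Poly_Mapping.single v 1)"
            using a_in by (auto simp: in_keys_iff lookup_add)
          ultimately show ?thesis using a_in by (simp only: sign m if_True) simp
        next
          case False
          then have "a \<notin> Poly_Mapping.keys (m + Poly_Mapping.single v 1)"
            using \<open>a \<noteq> v\<close> by (simp add: in_keys_iff lookup_add lookup_single)
          then show ?thesis using False by simp
        qed
      qed
      finally show ?thesis by (simp only: sum_negf) (simp add: eq_neg_iff_add_eq_0)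
    next
      case False
      then have v_keys: "v \<in> Poly_Mapping.keys m" using v(1) by simp
      have "(\<Sum>a\<in>-A. ?t a) = (\<Sum>a\<in>-A. if a = v then ?t v else 0)"
      proof (rule sum.cong[OF refl])
        fix a assume a: "a \<in> - A"
        show "?t a = (if a = v then ?t v else 0)"
        proof (cases "a \<noteq> v \<and> a \<in> Poly_Mapping.keys m")
          case True
          then have v_in: "v \<in> Poly_Mapping.keys (m - Poly_Mapping.single a 1)"
            using v_keys by (auto simp: in_keys_iff lookup_minus lookup_single)
          obtain u where u: "u \<in> insert a A" "\<And>x. x \<in> insert a A \<Longrightarrow> idx u \<le> idx x"
            by (rule ex_least[of "insert a A"]) auto
          have "idx v < idx u" using v_less[of u] u(1) True False by auto
          then have "?c (koszul_contraction f) (insert a A) (m - Poly_Mapping.single a 1) = 0"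
            using v_in by (subst lookup_koszul_contraction[OF u]) auto
          then show ?thesis using True by simp
        qed auto
      qed
      also have "\<dots> = ?t v" using False by simp
      also have "\<dots> = ?c f A m"
      proof -
        have sign: "koszul_sign v A = (1 :: 'k)" by (rule koszul_sign_least) (use v in auto)
        have m: "m - Poly_Mapping.single v 1 + Poly_Mapping.single v 1 = m"
          using v_keys by (intro poly_mapping_eqI) (auto simp: in_keys_iff lookup_add lookup_minus lookup_single when_def)
        have "?c (koszul_contraction f) (insert v A) (m - Poly_Mapping.single v 1) = ?c f (insert v A - {v}) m"
          using v keys_minus by (subst lookup_koszul_contraction[where v = v]) (auto simp: m[unfolded One_nat_def])
        then show ?thesis using False v_keys sign by simp
      qed
      finally show ?thesis ..
    qed
  qed
  then show "?c f A m = ?c (koszul_diff fscale (koszul_contraction f)) A m"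
    by (simp only: lookup_koszul_diff)
qed

lemma keys_koszul_contraction:
  assumes "\<And>A. Poly_Mapping.keys (f A) \<subseteq> B"
  shows "Poly_Mapping.keys (koszul_contraction f A) \<subseteq> B"
  using assms by (auto simp: koszul_contraction_def in_keys_iff Poly_Mapping.map.rep_eq when_def subset_iff)

end

section \<open>Koszul classes detect Tor\<close>

definition const_part :: "(nat \<Rightarrow>\<^sub>0 ('a, 'k::comm_ring_1) mpolynomial) \<Rightarrow> (nat \<Rightarrow>\<^sub>0 'k)" where
  "const_part v = Poly_Mapping.map (\<lambda>f. Poly_Mapping.lookup f 0) v"

definition const_lift :: "(nat \<Rightarrow>\<^sub>0 'k::comm_ring_1) \<Rightarrow> (nat \<Rightarrow>\<^sub>0 ('a, 'k) mpolynomial)" where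
  "const_lift w = Poly_Mapping.map (\<lambda>c. Poly_Mapping.single 0 c) w"

lemma tensor_diff_eq: "tensor_diff C i w = const_part (diff C i (const_lift w))"
  by (simp add: tensor_diff_def const_part_def const_lift_def)

lemma lookup_const_part: "Poly_Mapping.lookup (const_part v) b = Poly_Mapping.lookup (Poly_Mapping.lookup v b) 0"
  by (simp add: const_part_def Poly_Mapping.map.rep_eq when_def)

lemma lookup_const_lift: "Poly_Mapping.lookup (const_lift w) b = Poly_Mapping.single 0 (Poly_Mapping.lookup w b)"
  by (simp add: const_lift_def Poly_Mapping.map.rep_eq when_def)

lemma const_part_diff: "const_part (v - w) = const_part v - const_part w"
  by (rule poly_mapping_eqI) (simp add: lookup_const_part lookup_minus)

lemma const_part_zero: "const_part 0 = 0"
  by (rule poly_mapping_eqI) (simp add: lookup_const_part)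

lemma const_part_add: "const_part (v + w) = const_part v + const_part w"
  by (rule poly_mapping_eqI) (simp add: lookup_const_part lookup_add)

lemma const_part_scale:
  "const_part (fscale (Poly_Mapping.single 0 c) v) = fscale c (const_part v)"
  by (rule poly_mapping_eqI) (simp add: lookup_const_part lookup_fscale lookup_const_mult)

lemma const_lift_add: "const_lift (v + w) = const_lift v + const_lift w"
  by (rule poly_mapping_eqI) (simp add: lookup_const_lift lookup_add single_add)

lemma const_lift_scale: "const_lift (fscale c v) = fscale (Poly_Mapping.single 0 c) (const_lift v)"
  by (rule poly_mapping_eqI) (simp add: lookup_const_lift lookup_fscale mult_single)

lemma const_part_const_lift [simp]: "const_part (const_lift w) = w"
  by (rule poly_mapping_eqI) (simp add: lookup_const_part lookup_const_lift)

lemma keys_const_lift: "Poly_Mapping.keys (const_lift w) \<subseteq> Poly_Mapping.keys w"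
  by (auto simp: in_keys_iff lookup_const_lift)

lemma keys_const_part: "Poly_Mapping.keys (const_part v) \<subseteq> Poly_Mapping.keys v"
  by (auto simp: in_keys_iff lookup_const_part)

lemma subspace_free_part: "fmod.subspace (free_part C i)"
  unfolding free_part_def by (rule subspace_keys)

lemma free_graded_part_subset: "free_graded_part C i j \<subseteq> free_part C i"
  by (auto simp: free_graded_part_def)

context vector_space
begin

lemma dim_less_of_psubset:
  assumes "subspace W" "W \<subseteq> V" "w \<in> V" "w \<notin> W" "finite F" "V \<subseteq> span F"
  shows "dim W < dim V"
proof -
  obtain B where B: "B \<subseteq> W" "independent B" "W \<subseteq> span B" "card B = dim W"
    using basis_exists by blast
  obtain B' where B': "B' \<subseteq> V" "independent B'" "V \<subseteq> span B'" "card B' = dim V"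
    using basis_exists by blast
  have finB': "finite B'"
    using independent_span_bound[OF assms(5) B'(2)] B'(1) assms(6) by auto
  have "span B \<subseteq> W" using B(1) assms(1) by (rule span_minimal)
  then have "w \<notin> span B" using assms(4) by auto
  then have indep: "independent (insert w B)" by (rule independent_insertI) (rule B(2))
  have "insert w B \<subseteq> span B'" using B(1) B'(3) assms(2,3) by auto
  then have bound: "finite (insert w B)" "card (insert w B) \<le> card B'"
    using independent_span_bound[OF finB' indep] by auto
  have "w \<notin> B" using B(1) assms(4) by auto
  with bound show ?thesis using B(4) B'(4) by simp
qed

end

text \<open>The linear functional on the polynomial ring with prescribed values on the monomials.\<close>

definition pairing :: "(('a \<Rightarrow>\<^sub>0 nat) \<Rightarrow> 'k) \<Rightarrow> ('a, 'k::comm_ring_1) mpolynomial \<Rightarrow> 'k" where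
  "pairing g p = (\<Sum>m\<in>Poly_Mapping.keys p. Poly_Mapping.lookup p m * g m)"

lemma pairing_superset:
  assumes "finite X" "Poly_Mapping.keys p \<subseteq> X"
  shows "pairing g p = (\<Sum>m\<in>X. Poly_Mapping.lookup p m * g m)"
  unfolding pairing_def by (rule sum.mono_neutral_left) (use assms in \<open>auto simp: in_keys_iff\<close>)

lemma pairing_zero [simp]: "pairing g 0 = 0"
  by (simp add: pairing_def)

lemma pairing_single [simp]: "pairing g (Poly_Mapping.single m c) = c * g m"
  by (subst pairing_superset[of "{m}"]) simp_all

lemma pairing_add: "pairing g (p + q) = pairing g p + pairing g q"
proof -
  let ?X = "Poly_Mapping.keys p \<union> Poly_Mapping.keys q"
  have "pairing g (p + q) = (\<Sum>m\<in>?X. Poly_Mapping.lookup (p + q) m * g m)"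
    by (rule pairing_superset) (use Poly_Mapping.keys_add[of p q] in auto)
  then show ?thesis
    by (simp add: pairing_superset[of ?X] lookup_add distrib_right sum.distrib)
qed

lemma pairing_sum: "pairing g (\<Sum>x\<in>X. f x) = (\<Sum>x\<in>X. pairing g (f x))"
  by (induction X rule: infinite_finite_induct) (simp_all add: pairing_add)

lemma pairing_minus: "pairing g (- p) = - pairing g p"
proof -
  have "pairing g (- p) + pairing g p = 0" by (simp flip: pairing_add)
  then show ?thesis by (simp add: eq_neg_iff_add_eq_0)
qed

lemma pairing_diff: "pairing g (p - q) = pairing g p - pairing g q"
  using pairing_add[of g p "- q"] by (simp add: pairing_minus)

lemma pairing_single_mult:
  "pairing g (Poly_Mapping.single t c * p) = c * pairing (\<lambda>m. g (t + m)) p"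
proof -
  have "pairing g (Poly_Mapping.single t c * p) =
      (\<Sum>n\<in>Poly_Mapping.keys p. c * Poly_Mapping.lookup p n * g (t + n))"
    by (simp only: single_mult_eq_sum pairing_sum pairing_single)
  also have "\<dots> = c * pairing (\<lambda>m. g (t + m)) p"
    by (simp only: pairing_def sum_distrib_left mult.assoc)
  finally show ?thesis .
qed

lemma pairing_mult_eq_0:
  assumes "\<And>t. pairing g (Poly_Mapping.single t 1 * q) = 0"
  shows "pairing g (p * q) = 0"
proof -
  have "pairing g (Poly_Mapping.single t c * q) = 0" for t c
    using assms[of t] by (simp add: pairing_single_mult)
  then show ?thesis
    by (subst sum_single_lookup[of p]) (simp only: sum_distrib_right pairing_sum sum.neutral_const)
qed

context variable_order
begin

lemma const_part_koszul_diff: "const_part (koszul_diff fscale f A) = 0"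
  by (rule poly_mapping_eqI) (simp add: lookup_const_part lookup_koszul_diff)

text \<open>The element \<open>v\<close> has its coefficients in the maximal ideal; placed at the empty set it is a cycle
without constant terms, hence a boundary.  This expresses \<open>v\<close> as a combination of multiples of the
variables.\<close>

lemma koszul_diff_concentrated:
  assumes "const_part v = (0 :: nat \<Rightarrow>\<^sub>0 'k::comm_ring_1)" "Poly_Mapping.keys v \<subseteq> B"
  shows "\<exists>t. (\<forall>A. Poly_Mapping.keys (t A) \<subseteq> B) \<and> (\<forall>A. (if A = {} then v else 0) = koszul_diff fscale t A)"
proof -
  let ?f = "\<lambda>A :: 'a set. if A = {} then v else 0"
  have "koszul_diff fscale ?f A = 0" for A
    by (simp add: koszul_diff_def)
  moreover have "Poly_Mapping.lookup (Poly_Mapping.lookup (?f {}) b) 0 = 0" for b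
    using arg_cong[OF assms(1), of "\<lambda>w. Poly_Mapping.lookup w b"] by (simp add: lookup_const_part)
  ultimately have "?f A = koszul_diff fscale (koszul_contraction ?f) A" for A
    by (rule koszul_exact)
  moreover have "Poly_Mapping.keys (koszul_contraction ?f A) \<subseteq> B" for A
    by (rule keys_koszul_contraction) (simp add: assms(2))
  ultimately show ?thesis by blast
qed

lemma const_part_hom:
  fixes d :: "(nat \<Rightarrow>\<^sub>0 ('a, 'k::comm_ring_1) mpolynomial) \<Rightarrow> (nat \<Rightarrow>\<^sub>0 ('a, 'k) mpolynomial)"
  assumes hom: "module_hom fscale fscale d" and "const_part v = 0"
  shows "const_part (d v) = 0"
proof -
  obtain t where t: "\<And>A :: 'a set. (if A = {} then v else 0) = koszul_diff fscale t A"
    using koszul_diff_concentrated[OF assms(2), of UNIV] by auto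
  have "d v = d (koszul_diff fscale t {})"
    using t[of "{}"] by simp
  also have "\<dots> = koszul_diff fscale (\<lambda>A. d (t A)) {}"
    by (rule koszul_diff_hom[OF hom])
  finally show ?thesis by (simp only: const_part_koszul_diff)
qed

lemma tensor_diff_const_part:
  assumes "module_hom fscale fscale (diff C i)"
  shows "tensor_diff C i (const_part v) = const_part (diff C i (v :: nat \<Rightarrow>\<^sub>0 ('a, 'k::field) mpolynomial))"
proof -
  interpret module_hom fscale fscale "diff C i" by (rule assms)
  have "const_part (diff C i (v - const_lift (const_part v))) = 0"
    by (rule const_part_hom[OF assms]) (simp add: const_part_diff)
  then show ?thesis by (simp add: tensor_diff_eq diff const_part_diff)
qed

text \<open>The premise says that the transpose of the Koszul differential maps the functional \<open>\<psi>\<close> to zero.\<close>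

lemma sum_pairing_koszul_diff:
  assumes coboundary: "\<And>A m. (\<Sum>a\<in>A. koszul_sign a (A - {a}) * \<psi> (A - {a}) (m + Poly_Mapping.single a 1)) = (0 :: 'k::comm_ring_1)"
  shows "(\<Sum>A\<in>UNIV. pairing (\<psi> A) (koszul_diff (*) g A)) = 0"
proof -
  let ?F = "\<lambda>A a B. koszul_sign a A * pairing (\<lambda>m. \<psi> A (m + Poly_Mapping.single a 1)) (g B)"
  have sign: "koszul_sign a A * var a * p = Poly_Mapping.single (Poly_Mapping.single a 1) (koszul_sign a A) * p"
    for a A and p :: "('a, 'k) mpolynomial"
    by (subst koszul_sign_eq_single) (simp only: var_def mult_single add_0_left mult_1_right)
  have "(\<Sum>A\<in>UNIV. pairing (\<psi> A) (koszul_diff (*) g A)) = (\<Sum>A\<in>UNIV. \<Sum>a\<in>-A. ?F A a (insert a A))"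
    by (simp only: koszul_diff_def pairing_sum sign pairing_single_mult add.commute)
  also have "\<dots> = (\<Sum>(A, a)\<in>(SIGMA A:UNIV. -A). ?F A a (insert a A))"
    by (rule sum.Sigma) simp_all
  also have "\<dots> = (\<Sum>(B, a)\<in>(SIGMA B:UNIV. B). ?F (B - {a}) a B)"
    by (rule sum.reindex_bij_witness[where i = "\<lambda>(B, a). (B - {a}, a)" and j = "\<lambda>(A, a). (insert a A, a)"])
      (auto simp: insert_absorb)
  also have "\<dots> = (\<Sum>B\<in>UNIV. \<Sum>a\<in>B. ?F (B - {a}) a B)"
    by (rule sum.Sigma[symmetric]) simp_all
  also have "\<dots> = 0"
  proof (rule sum.neutral, rule ballI)
    fix B :: "'a set"
    let ?c = "Poly_Mapping.lookup (g B)"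
    have "(\<Sum>a\<in>B. ?F (B - {a}) a B) = (\<Sum>a\<in>B. \<Sum>m\<in>Poly_Mapping.keys (g B).
        ?c m * (koszul_sign a (B - {a}) * \<psi> (B - {a}) (m + Poly_Mapping.single a 1)))"
      by (simp only: pairing_def sum_distrib_left mult.left_commute)
    also have "\<dots> = (\<Sum>m\<in>Poly_Mapping.keys (g B). ?c m *
        (\<Sum>a\<in>B. koszul_sign a (B - {a}) * \<psi> (B - {a}) (m + Poly_Mapping.single a 1)))"
      by (subst sum.swap) (simp only: sum_distrib_left)
    also have "\<dots> = 0" by (simp only: coboundary mult_zero_right sum.neutral_const)
    finally show "(\<Sum>a\<in>B. ?F (B - {a}) a B) = 0" .
  qed
  finally show ?thesis .
qed

text \<open>The part of total degree $e + q$ at the position $(p, q)$ of the double complex.\<close>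

definition koszul_chains ::
    "('a, 'k::comm_ring_1) free_sequence \<Rightarrow> nat \<Rightarrow> nat \<Rightarrow> nat \<Rightarrow> ('a set \<Rightarrow> (nat \<Rightarrow>\<^sub>0 ('a, 'k) mpolynomial)) set" where
  "koszul_chains C p q e = {f. \<forall>A. if card A = q then f A \<in> free_graded_part C p e else f A = 0}"

lemma koszul_chains_free_part: "f \<in> koszul_chains C p q e \<Longrightarrow> f A \<in> free_part C p"
  using fmod.subspace_0[OF subspace_free_part[of C p]]
    free_graded_part_subset[of C p e]
  by (cases "card A = q") (auto simp: koszul_chains_def dest!: spec[of _ A])

lemma koszul_diff_free_part:
  "(\<And>A. f A \<in> free_part C p) \<Longrightarrow> koszul_diff fscale f A \<in> free_part C p"
  by (rule koszul_diff_subspace[OF fmod.module_axioms subspace_free_part])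

lemma koszul_diff_chain:
  assumes f: "f \<in> koszul_chains C p (Suc q) e"
  shows "koszul_diff fscale f \<in> koszul_chains C p q (Suc e)"
  unfolding koszul_chains_def
proof (intro CollectI allI)
  fix A
  show "if card A = q then koszul_diff fscale f A \<in> free_graded_part C p (Suc e) else koszul_diff fscale f A = 0"
  proof (cases "card A = q")
    case True
    have "koszul_diff fscale f A \<in> graded_part (basis C p) (shift C p) (Suc e)"
    proof (rule graded_partI)
      show "Poly_Mapping.keys (koszul_diff fscale f A) \<subseteq> basis C p"
        using koszul_diff_free_part[of f C p, OF koszul_chains_free_part[OF f]] by (simp add: free_part_def)
      fix b m assume "Poly_Mapping.lookup (Poly_Mapping.lookup (koszul_diff fscale f A) b) m \<noteq> 0"
      then obtain a where "a \<in> - A" and nz: "koszul_sign a A * (if a \<in> Poly_Mapping.keys m then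
          Poly_Mapping.lookup (Poly_Mapping.lookup (f (insert a A)) b) (m - Poly_Mapping.single a 1) else 0) \<noteq> 0"
        unfolding lookup_koszul_diff by (rule sum.not_neutral_contains_not_neutral)
      have "(if a \<in> Poly_Mapping.keys m then
          Poly_Mapping.lookup (Poly_Mapping.lookup (f (insert a A)) b) (m - Poly_Mapping.single a 1) else 0) \<noteq> 0"
        using nz by (metis mult_zero_right)
      then have a: "a \<notin> A" "a \<in> Poly_Mapping.keys m"
          "Poly_Mapping.lookup (Poly_Mapping.lookup (f (insert a A)) b) (m - Poly_Mapping.single a 1) \<noteq> 0"
        using \<open>a \<in> - A\<close> by (auto split: if_splits)
      have "f (insert a A) \<in> graded_part (basis C p) (shift C p) e"
        using f a(1) True by (auto simp: koszul_chains_def free_graded_part_eq dest!: spec[of _ "insert a A"])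
      then have deg: "monomial_degree (m - Poly_Mapping.single a 1) + shift C p b = e"
        using a(3) by (rule graded_partD)
      have "m = Poly_Mapping.single a 1 + (m - Poly_Mapping.single a 1)"
        using a(2) by (intro poly_mapping_eqI) (auto simp: lookup_add lookup_minus lookup_single when_def in_keys_iff)
      then have "monomial_degree m = monomial_degree (Poly_Mapping.single a 1) + monomial_degree (m - Poly_Mapping.single a 1)"
        by (metis monomial_degree_add)
      then show "monomial_degree m + shift C p b = Suc e" using deg by simp
    qed
    then show ?thesis using True by (simp add: free_graded_part_eq)
  next
    case False
    have "f (insert a A) = 0" if "a \<notin> A" for a
    proof -
      have "card (insert a A) \<noteq> Suc q" using that False by simp
      then show ?thesis using f by (auto simp: koszul_chains_def)
    qed
    then have "koszul_diff fscale f A = 0" by (simp add: koszul_diff_def)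
    then show ?thesis using False by simp
  qed
qed

text \<open>Any preimage can be replaced by its component of the right degree.\<close>

lemma graded_preimage:
  fixes C :: "('a, 'k::comm_ring_1) free_sequence"
  assumes hom: "module_hom fscale fscale (diff C p)"
    and graded: "\<And>j. diff C p ` free_graded_part C (Suc p) j \<subseteq> free_graded_part C p j"
    and v: "v \<in> free_graded_part C p j" "v \<in> diff C p ` free_part C (Suc p)"
  shows "\<exists>u\<in>free_graded_part C (Suc p) j. diff C p u = v"
proof -
  obtain u where u: "u \<in> free_part C (Suc p)" "v = diff C p u" using v(2) by blast
  let ?u = "degree_component (shift C (Suc p)) j u"
  have "Poly_Mapping.keys u \<subseteq> basis C (Suc p)" using u(1) by (simp add: free_part_def)
  then have "?u \<in> free_graded_part C (Suc p) j"
    unfolding free_graded_part_eq by (rule degree_component_in_graded_part)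
  moreover have "diff C p ?u = degree_component (shift C p) j v"
    unfolding u(2)
    using module_hom_degree_component[OF hom graded[unfolded free_graded_part_eq]] u(1)
    by (simp add: free_part_def)
  moreover have "degree_component (shift C p) j v = v"
    using degree_component_graded[of v "basis C p" "shift C p" j j] v(1) by (simp add: free_graded_part_eq)
  ultimately show ?thesis by auto
qed

text \<open>Of a preimage only the component of degree \<open>e\<close> is kept; the error stays in \<open>I\<close> because \<open>I\<close> is
homogeneous.\<close>

lemma graded_augmentation:
  fixes C :: "('a, 'k::comm_ring_1) free_sequence"
  assumes hom: "module_hom fscale (*) \<epsilon>"
    and graded: "\<And>j. \<epsilon> ` free_graded_part C 0 j \<subseteq> homogeneous_part j"
    and surj: "\<exists>v\<in>free_part C 0. f - \<epsilon> v \<in> I"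
    and homogeneous: "\<And>f j. f \<in> I \<Longrightarrow> filter_keys (\<lambda>m. monomial_degree m = j) f \<in> I"
    and f: "f \<in> homogeneous_part e"
  shows "\<exists>v\<in>free_graded_part C 0 e. f - \<epsilon> v \<in> I"
proof -
  interpret \<epsilon>: module_hom fscale "(*)" \<epsilon> by (rule hom)
  obtain v where v: "v \<in> free_part C 0" "f - \<epsilon> v \<in> I" using surj by blast
  let ?H = "filter_keys (\<lambda>m. monomial_degree m = e)"
  let ?v = "\<lambda>j. degree_component (shift C 0) j v"
  obtain J where J: "finite J" "v = (\<Sum>j\<in>J. ?v j)" using degree_decomposition by blast
  have v_in: "?v j \<in> free_graded_part C 0 j" for j
    unfolding free_graded_part_eq using v(1) by (intro degree_component_in_graded_part) (simp add: free_part_def)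
  have "Poly_Mapping.keys (\<epsilon> (?v j)) \<subseteq> {m. monomial_degree m = j}" for j
    using graded[of j] v_in[of j] by (auto simp: homogeneous_part_def)
  then have H: "?H (\<epsilon> (?v j)) = (if j = e then \<epsilon> (?v j) else 0)" for j
    by (auto intro!: filter_keys_id filter_keys_none)
  define u where "u = (if e \<in> J then ?v e else 0)"
  have "\<epsilon> v = (\<Sum>j\<in>J. \<epsilon> (?v j))" by (subst (1) J(2)) (rule \<epsilon>.sum)
  then have "?H (\<epsilon> v) = (\<Sum>j\<in>J. if j = e then \<epsilon> (?v j) else 0)" by (simp only: filter_keys_sum H)
  also have "\<dots> = (if e \<in> J then \<epsilon> (?v e) else 0)" by (rule sum.delta[OF J(1)])
  also have "\<dots> = \<epsilon> u" by (simp add: u_def \<epsilon>.zero)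
  finally have "?H (\<epsilon> v) = \<epsilon> u" .
  moreover have "?H f = f" using f by (intro filter_keys_id) (auto simp: homogeneous_part_def)
  ultimately have "f - \<epsilon> u = ?H (f - \<epsilon> v)" by (simp add: filter_keys_diff)
  then have "f - \<epsilon> u \<in> I" using homogeneous[OF v(2)] by simp
  moreover have "u \<in> free_graded_part C 0 e"
    using v_in by (simp add: u_def) (simp add: free_graded_part_def free_part_def)
  ultimately show ?thesis by blast
qed

text \<open>Let \<open>C\<close> be a graded free resolution of $S/I$ and write \<open>d\<close> for its differential and $\partial$ for
that of the Koszul complex.  Lift \<open>z\<close> to a chain $\zeta_0$ with coefficients in \<open>C\<^sub>0\<close>.  Its boundary
has coefficients in \<open>I\<close>, so $\partial\zeta_0 = d\zeta_1$ with coefficients of $\zeta_1$ in \<open>C\<^sub>1\<close>, and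
then $\partial\zeta_1$ is in the kernel of \<open>d\<close>, and so on up to $\zeta_i$, which has Koszul degree $0$
and is an element of \<open>C\<^sub>i\<close>.  Its constant part \<open>w\<close> is a cycle of $C \otimes K$, because
$d\zeta_i = \partial\zeta_{i-1}$ has coefficients in the maximal ideal.

If \<open>w\<close> were a boundary, then $\zeta_i = dU + \partial t$.  Descending, $\zeta_{p+1} = dU + \partial t$
yields $\partial(\zeta_p - dt) = 0$ and hence $\zeta_p = dt + \partial t'$ by exactness of the Koszul
complex.  At $p = 0$ this makes \<open>z\<close> a boundary up to coefficients in \<open>I\<close>, which contradicts the
functional \<open>\<psi>\<close>.\<close>

theorem koszul_class_imp_betti_pos:
  fixes I :: "('a, 'k::field) mpolynomial set"
  assumes ideal: "ring_mod.subspace I"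
    and homogeneous: "\<And>f j. f \<in> I \<Longrightarrow> filter_keys (\<lambda>m. monomial_degree m = j) f \<in> I"
    and i: "i = Suc i'"
    and z: "\<And>A. card A = i \<Longrightarrow> z A \<in> homogeneous_part e" "\<And>A. card A \<noteq> i \<Longrightarrow> z A = 0"
    and z_cycle: "\<And>A. koszul_diff (*) z A \<in> I"
    and \<psi>_ideal: "\<And>A p. p \<in> I \<Longrightarrow> pairing (\<psi> A) p = 0"
    and coboundary: "\<And>A m. (\<Sum>a\<in>A. koszul_sign a (A - {a}) * \<psi> (A - {a}) (m + Poly_Mapping.single a 1)) = 0"
    and nonzero: "(\<Sum>A\<in>UNIV. pairing (\<psi> A) (z A)) \<noteq> 0"
  shows "betti I i (e + i) > 0"
proof -
  define C where "C = (SOME C. graded_free_resolution I C)"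
  have res: "graded_free_resolution I C"
    unfolding C_def by (rule someI_ex) (rule graded_free_resolution_exists[OF ideal homogeneous])
  note res' = res[unfolded graded_free_resolution_def]
  have fin: "\<And>i j. finite {b \<in> basis C i. shift C i b = j}"
    by (rule res'[THEN conjunct1, THEN spec, THEN spec])
  have hom: "\<And>i. module_hom fscale fscale (diff C i)"
    by (rule res'[THEN conjunct2, THEN conjunct1, THEN spec])
  have graded: "\<And>i j. diff C i ` free_graded_part C (Suc i) j \<subseteq> free_graded_part C i j"
    by (rule res'[THEN conjunct2, THEN conjunct2, THEN conjunct1, THEN spec, THEN spec])
  have exact: "\<And>i. {v \<in> free_part C (Suc i). diff C i v = 0} = diff C (Suc i) ` free_part C (Suc (Suc i))"
    by (rule res'[THEN conjunct2, THEN conjunct2, THEN conjunct2, THEN conjunct1, THEN spec])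
  obtain \<epsilon> where \<epsilon>_hom: "module_hom fscale (*) \<epsilon>"
    and \<epsilon>_graded: "\<And>j. \<epsilon> ` free_graded_part C 0 j \<subseteq> homogeneous_part j"
    and \<epsilon>_surj: "\<And>f. \<exists>v\<in>free_part C 0. f - \<epsilon> v \<in> I"
    and exact0: "{v \<in> free_part C 0. \<epsilon> v \<in> I} = diff C 0 ` free_part C (Suc 0)"
    using res'[THEN conjunct2, THEN conjunct2, THEN conjunct2, THEN conjunct2] by meson
  interpret d: module_hom fscale fscale "diff C q" for q by (rule hom)
  interpret \<epsilon>: module_hom fscale "(*)" \<epsilon> by (rule \<epsilon>_hom)
  let ?D = "koszul_diff fscale"
  have dd: "diff C p (diff C (Suc p) v) = 0" if "v \<in> free_part C (Suc (Suc p))" for p v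
    using exact[of p] that by blast
  have \<epsilon>d: "\<epsilon> (diff C 0 v) \<in> I" if "v \<in> free_part C (Suc 0)" for v
    using exact0 that by blast

  define ok where "ok p f \<longleftrightarrow> f \<in> koszul_chains C p (i - p) (e + p) \<and>
      (\<forall>A. ?D f A \<in> diff C p ` free_part C (Suc p)) \<and> (p = 0 \<longrightarrow> (\<forall>A. z A - \<epsilon> (f A) \<in> I))" for p f
  have ok0: "\<exists>f. ok 0 f"
  proof -
    have "\<exists>v. z A - \<epsilon> v \<in> I \<and> (if card A = i then v \<in> free_graded_part C 0 e else v = 0)" for A
    proof (cases "card A = i")
      case True
      then show ?thesis
        using graded_augmentation[OF \<epsilon>_hom \<epsilon>_graded \<epsilon>_surj homogeneous z(1)[of A]] by auto
    next
      case False
      then show ?thesis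
        using z(2)[of A] by (simp add: \<epsilon>.zero ring_mod.subspace_0[OF ideal])
    qed
    then obtain f where f: "\<And>A. z A - \<epsilon> (f A) \<in> I"
        "\<And>A. if card A = i then f A \<in> free_graded_part C 0 e else f A = 0" by metis
    have chain: "f \<in> koszul_chains C 0 i e" using f(2) by (simp add: koszul_chains_def)
    have "?D f A \<in> diff C 0 ` free_part C (Suc 0)" for A
    proof -
      have "koszul_diff (*) (\<lambda>A. z A - \<epsilon> (f A)) A \<in> I"
        by (rule koszul_diff_subspace[OF ring_mod.module_axioms ideal f(1)])
      then have "koszul_diff (*) z A - (koszul_diff (*) z A - \<epsilon> (?D f A)) \<in> I"
        using ring_mod.subspace_diff[OF ideal z_cycle[of A]]
        by (simp only: koszul_diff_minus[OF ring_mod.module_axioms] koszul_diff_hom[OF \<epsilon>_hom])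
      then have "\<epsilon> (?D f A) \<in> I" by simp
      then have "?D f A \<in> {v \<in> free_part C 0. \<epsilon> v \<in> I}"
        using koszul_diff_free_part[OF koszul_chains_free_part[OF chain]] by simp
      then show ?thesis by (simp only: exact0)
    qed
    then have "ok 0 f" using chain f(1) by (simp add: ok_def)
    then show ?thesis by blast
  qed
  have ok_Suc: "\<exists>g. ok (Suc p) g \<and> (\<forall>A. diff C p (g A) = ?D f A)" if "p < i" "ok p f" for p f
  proof -
    have "f \<in> koszul_chains C p (Suc (i - Suc p)) (e + p)" using that by (simp add: ok_def Suc_diff_Suc)
    then have chain: "?D f \<in> koszul_chains C p (i - Suc p) (Suc (e + p))" by (rule koszul_diff_chain)
    have "\<exists>u. diff C p u = ?D f A \<and>
        (if card A = i - Suc p then u \<in> free_graded_part C (Suc p) (e + Suc p) else u = 0)" for A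
    proof (cases "card A = i - Suc p")
      case True
      then have "?D f A \<in> free_graded_part C p (e + Suc p)" "?D f A \<in> diff C p ` free_part C (Suc p)"
        using chain that(2) by (auto simp: koszul_chains_def ok_def)
      then obtain u where "u \<in> free_graded_part C (Suc p) (e + Suc p)" "diff C p u = ?D f A"
        using graded_preimage[OF hom graded] by blast
      then show ?thesis using True by auto
    next
      case False
      then have "?D f A = 0" using chain by (auto simp: koszul_chains_def)
      then show ?thesis using False by (simp add: d.zero)
    qed
    then obtain g where g: "\<And>A. diff C p (g A) = ?D f A"
        "\<And>A. if card A = i - Suc p then g A \<in> free_graded_part C (Suc p) (e + Suc p) else g A = 0" by metis
    have g_chain: "g \<in> koszul_chains C (Suc p) (i - Suc p) (e + Suc p)"
      using g(2) unfolding koszul_chains_def by blast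
    have "?D g A \<in> diff C (Suc p) ` free_part C (Suc (Suc p))" for A
    proof -
      have "diff C p (?D g A) = ?D (?D f) A"
        by (simp only: koszul_diff_hom[OF hom] g(1))
      also have "\<dots> = 0" by (rule koszul_diff_koszul_diff[OF fmod.module_axioms])
      finally have "?D g A \<in> {v \<in> free_part C (Suc p). diff C p v = 0}"
        using koszul_diff_free_part[OF koszul_chains_free_part[OF g_chain]] by simp
      then show ?thesis by (simp only: exact)
    qed
    then have "ok (Suc p) g" using g_chain by (simp add: ok_def)
    then show ?thesis using g(1) by blast
  qed
  have "\<exists>\<zeta>. \<forall>p. (p \<le> i \<longrightarrow> ok p (\<zeta> p)) \<and> (p < i \<longrightarrow> (\<forall>A. diff C p (\<zeta> (Suc p) A) = ?D (\<zeta> p) A))"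
  proof (rule dependent_nat_choice)
    show "\<exists>f. 0 \<le> i \<longrightarrow> ok 0 f" using ok0 by blast
    show "\<exists>g. (Suc p \<le> i \<longrightarrow> ok (Suc p) g) \<and> (p < i \<longrightarrow> (\<forall>A. diff C p (g A) = ?D f A))"
      if "p \<le> i \<longrightarrow> ok p f" for f p
      using ok_Suc[of p f] that by (cases "p < i") auto
  qed
  then obtain \<zeta> where \<zeta>: "\<And>p. p \<le> i \<Longrightarrow> ok p (\<zeta> p)"
      "\<And>p A. p < i \<Longrightarrow> diff C p (\<zeta> (Suc p) A) = ?D (\<zeta> p) A" by blast
  have \<zeta>_free: "\<zeta> p A \<in> free_part C p" if "p \<le> i" for p A
    using \<zeta>(1)[OF that] koszul_chains_free_part by (auto simp: ok_def)

  define w where "w = const_part (\<zeta> i {})"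
  have \<zeta>_top: "\<zeta> i {} \<in> graded_part (basis C i) (shift C i) (e + i)" "\<And>A. A \<noteq> {} \<Longrightarrow> \<zeta> i A = 0"
    using \<zeta>(1)[of i] by (auto simp: ok_def koszul_chains_def free_graded_part_eq dest!: spec[of _ "{} :: 'a set"])
  have w_part: "w \<in> tensor_part C i (e + i)"
  proof -
    have "b \<in> basis C i \<and> shift C i b = e + i" if "b \<in> Poly_Mapping.keys w" for b
    proof -
      have "b \<in> Poly_Mapping.keys (\<zeta> i {})" using that keys_const_part by (auto simp: w_def)
      moreover have "Poly_Mapping.lookup (Poly_Mapping.lookup (\<zeta> i {}) b) 0 \<noteq> 0"
        using that by (simp add: w_def in_keys_iff lookup_const_part)
      ultimately show ?thesis
        using \<zeta>_top(1) graded_partD[OF \<zeta>_top(1), of b 0] by (auto simp: graded_part_def)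
    qed
    then show ?thesis by (auto simp: tensor_part_def)
  qed
  have "tensor_diff C i' w = const_part (diff C i' (\<zeta> i {}))"
    unfolding w_def by (rule tensor_diff_const_part[OF hom])
  also have "\<dots> = 0"
    using \<zeta>(2)[of i' "{}"] by (simp add: i const_part_koszul_diff)
  finally have w_cycle: "w \<in> tor_cycles C i (e + i)"
    using w_part by (simp add: i)

  have w_not_boundary: "w \<notin> tor_boundaries C i (e + i)"
  proof
    assume "w \<in> tor_boundaries C i (e + i)"
    then obtain u where u: "u \<in> tensor_part C (Suc i) (e + i)" "w = tensor_diff C i u"
      by (auto simp: tor_boundaries_def)
    define bounds where "bounds p \<longleftrightarrow> (\<exists>U t. (\<forall>A. U A \<in> free_part C (Suc p) \<and> t A \<in> free_part C p \<and>
        \<zeta> p A = diff C p (U A) + ?D t A))" for p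
    have u_free: "const_lift u \<in> free_part C (Suc i)"
      using u(1) keys_const_lift[of u] by (auto simp: tensor_part_def free_part_def)
    have bounds_top: "bounds i"
    proof -
      let ?y = "\<zeta> i {} - diff C i (const_lift u)"
      have du_free: "diff C i (const_lift u) \<in> free_part C i"
      proof -
        have "diff C i' (diff C i (const_lift u)) = 0" using dd u_free by (simp add: i)
        then show ?thesis using exact[of i'] u_free by (auto simp: i)
      qed
      have y: "const_part ?y = 0"
        using u(2) by (simp add: const_part_diff w_def tensor_diff_eq)
      have "?y \<in> free_part C i"
        by (rule fmod.subspace_diff[OF subspace_free_part \<zeta>_free du_free]) simp
      then have "Poly_Mapping.keys ?y \<subseteq> basis C i" by (simp add: free_part_def)
      from koszul_diff_concentrated[OF y this] obtain t where
        t: "\<And>A. Poly_Mapping.keys (t A) \<subseteq> basis C i" "\<And>A. (if A = {} then ?y else 0) = ?D t A" by blast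
      let ?U = "\<lambda>A :: 'a set. if A = {} then const_lift u else 0"
      have "\<zeta> i A = diff C i (?U A) + ?D t A" for A
        unfolding t(2)[symmetric] using \<zeta>_top(2)[of A] by (simp add: d.zero)
      moreover have "?U A \<in> free_part C (Suc i)" for A
        using u_free by (simp add: free_part_def)
      moreover have "t A \<in> free_part C i" for A using t(1) by (simp add: free_part_def)
      ultimately show ?thesis unfolding bounds_def by (intro exI[of _ ?U] exI[of _ t]) blast
    qed
    have descend: "bounds p" if "bounds (Suc p)" "p < i" for p
    proof -
      obtain U t where Ut: "\<And>A. U A \<in> free_part C (Suc (Suc p))" "\<And>A. t A \<in> free_part C (Suc p)"
          "\<And>A. \<zeta> (Suc p) A = diff C (Suc p) (U A) + ?D t A"
        using \<open>bounds (Suc p)\<close> unfolding bounds_def by blast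
      \<comment> \<open>the value at the empty set has no influence on the Koszul boundary; clearing it removes the constant terms\<close>
      define t' where "t' A = (if A = {} then 0 else t A)" for A
      have t': "?D t' A = ?D t A" for A by (simp add: koszul_diff_def t'_def)
      have t'_free: "t' A \<in> free_part C (Suc p)" for A
        using Ut(2) by (simp add: t'_def) (simp add: free_part_def)
      let ?f = "\<lambda>A. \<zeta> p A - diff C p (t' A)"
      have "?D ?f A = 0" for A
      proof -
        have "?D (\<zeta> p) A = diff C p (diff C (Suc p) (U A) + ?D t' A)"
          using \<zeta>(2)[OF \<open>p < i\<close>, of A] by (simp only: Ut(3) t')
        also have "\<dots> = ?D (\<lambda>A. diff C p (t' A)) A"
          by (simp add: d.add dd[OF Ut(1)] koszul_diff_hom[OF hom])
        finally show ?thesis by (simp add: koszul_diff_minus[OF fmod.module_axioms])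
      qed
      moreover have "?f {} = 0"
        using \<zeta>(1)[of p] \<open>p < i\<close>
        by (auto simp: ok_def koszul_chains_def t'_def d.zero dest!: spec[of _ "{} :: 'a set"])
      then have "Poly_Mapping.lookup (Poly_Mapping.lookup (?f {}) b) 0 = 0" for b by simp
      ultimately have s: "?f A = ?D (koszul_contraction ?f) A" for A
        by (rule koszul_exact)
      have dt_free: "diff C p (t' A) \<in> free_part C p" for A
      proof (cases p)
        case 0
        then show ?thesis using exact0 t'_free[of A] by auto
      next
        case (Suc p')
        then show ?thesis using exact[of p'] t'_free[of A] by auto
      qed
      have "?f A \<in> free_part C p" for A
        by (rule fmod.subspace_diff[OF subspace_free_part \<zeta>_free dt_free]) (use \<open>p < i\<close> in simp)
      then have "koszul_contraction ?f A \<in> free_part C p" for A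
        unfolding free_part_def by (simp only: mem_Collect_eq keys_koszul_contraction)
      moreover have "\<zeta> p A = diff C p (t' A) + ?D (koszul_contraction ?f) A" for A
        unfolding s[symmetric] by simp
      ultimately show ?thesis unfolding bounds_def using t'_free by blast
    qed
    have "bounds 0"
      by (rule inc_induct[where P = bounds, OF le0[of i] bounds_top]) (rule descend)
    then obtain U t where Ut: "\<And>A. U A \<in> free_part C (Suc 0)" "\<And>A. \<zeta> 0 A = diff C 0 (U A) + ?D t A"
      unfolding bounds_def by blast
    have "pairing (\<psi> A) (z A) = pairing (\<psi> A) (koszul_diff (*) (\<lambda>A. \<epsilon> (t A)) A)" for A
    proof -
      have "z A - \<epsilon> (\<zeta> 0 A) \<in> I" using \<zeta>(1)[of 0] by (simp add: ok_def)
      then have "pairing (\<psi> A) (z A - \<epsilon> (\<zeta> 0 A)) = 0" by (rule \<psi>_ideal)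
      moreover have "pairing (\<psi> A) (\<epsilon> (diff C 0 (U A))) = 0" by (rule \<psi>_ideal[OF \<epsilon>d[OF Ut(1)]])
      ultimately show ?thesis
        by (simp add: Ut(2) \<epsilon>.add pairing_diff pairing_add koszul_diff_hom[OF \<epsilon>_hom])
    qed
    then have "(\<Sum>A\<in>UNIV. pairing (\<psi> A) (z A)) = 0"
      by (simp only: sum_pairing_koszul_diff[OF coboundary])
    with nonzero show False ..
  qed

  have boundaries_subset: "tor_boundaries C i j \<subseteq> tor_cycles C i j" for j
  proof
    fix x assume "x \<in> tor_boundaries C i j"
    then obtain u where u: "u \<in> tensor_part C (Suc i) j" "x = tensor_diff C i u"
      by (auto simp: tor_boundaries_def)
    have u': "const_lift u \<in> free_graded_part C (Suc i) j"
      unfolding free_graded_part_eq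
    proof (rule graded_partI)
      show "Poly_Mapping.keys (const_lift u :: nat \<Rightarrow>\<^sub>0 ('a, 'k) mpolynomial) \<subseteq> basis C (Suc i)"
        using u(1) keys_const_lift[of u] by (auto simp: tensor_part_def)
      fix b m assume "Poly_Mapping.lookup (Poly_Mapping.lookup (const_lift u) b) m \<noteq> (0 :: 'k)"
      then have "m = 0" "b \<in> Poly_Mapping.keys u"
        by (auto simp: lookup_const_lift lookup_single when_def in_keys_iff split: if_splits)
      then show "monomial_degree m + shift C (Suc i) b = j"
        using u(1) by (auto simp: tensor_part_def)
    qed
    let ?y = "diff C i (const_lift u)"
    have y: "?y \<in> graded_part (basis C i) (shift C i) j"
      using graded u' unfolding free_graded_part_eq by blast
    have x: "x = const_part ?y" by (simp add: u(2) tensor_diff_eq)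
    have "b \<in> basis C i \<and> shift C i b = j" if "b \<in> Poly_Mapping.keys x" for b
    proof -
      have "b \<in> Poly_Mapping.keys ?y" using that keys_const_part by (auto simp: x)
      moreover have "Poly_Mapping.lookup (Poly_Mapping.lookup ?y b) 0 \<noteq> 0"
        using that by (simp add: x in_keys_iff lookup_const_part)
      ultimately show ?thesis
        using y graded_partD[OF y, of b 0] by (auto simp: graded_part_def)
    qed
    then have "x \<in> tensor_part C i j" by (auto simp: tensor_part_def)
    moreover have "tensor_diff C i' x = const_part (diff C i' ?y)"
      unfolding x by (rule tensor_diff_const_part[OF hom])
    moreover have "diff C i' ?y = 0"
      using dd[of "const_lift u" i'] u' free_graded_part_subset by (auto simp: i)
    ultimately show "x \<in> tor_cycles C i j" by (simp add: i const_part_zero)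
  qed
  have boundaries_subspace: "fmod.subspace (tor_boundaries C i j)" for j
  proof -
    have part: "fmod.subspace (tensor_part C (Suc i) j)"
      using subspace_keys unfolding tensor_part_def by blast
    show ?thesis
      unfolding fmod.subspace_def tor_boundaries_def
    proof (intro conjI ballI allI)
      have "tensor_diff C i 0 = 0"
        using tensor_diff_const_part[OF hom, where v = 0] by (simp add: const_part_zero d.zero)
      then show "0 \<in> tensor_diff C i ` tensor_part C (Suc i) j"
        using fmod.subspace_0[OF part] by (metis image_eqI)
    next
      fix x y assume "x \<in> tensor_diff C i ` tensor_part C (Suc i) j" "y \<in> tensor_diff C i ` tensor_part C (Suc i) j"
      then obtain u v where uv: "u \<in> tensor_part C (Suc i) j" "v \<in> tensor_part C (Suc i) j"
          "x = tensor_diff C i u" "y = tensor_diff C i v" by blast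
      have "x + y = tensor_diff C i (u + v)"
        by (simp add: uv tensor_diff_eq const_lift_add d.add const_part_add)
      then show "x + y \<in> tensor_diff C i ` tensor_part C (Suc i) j"
        using fmod.subspace_add[OF part uv(1,2)] by blast
    next
      fix c x assume "x \<in> tensor_diff C i ` tensor_part C (Suc i) j"
      then obtain u where u: "u \<in> tensor_part C (Suc i) j" "x = tensor_diff C i u" by blast
      have "fscale c x = tensor_diff C i (fscale c u)"
        by (simp add: u tensor_diff_eq const_lift_scale d.scale const_part_scale)
      then show "fscale c x \<in> tensor_diff C i ` tensor_part C (Suc i) j"
        using fmod.subspace_scale[OF part u(1)] by blast
    qed
  qed
  have "fvec.dim (tor_boundaries C i (e + i)) < fvec.dim (tor_cycles C i (e + i))"
  proof (rule fvec.dim_less_of_psubset[OF boundaries_subspace boundaries_subset w_cycle w_not_boundary])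
    let ?F = "(\<lambda>b. Poly_Mapping.single b (1 :: 'k)) ` {b \<in> basis C i. shift C i b = e + i}"
    show "finite ?F" by (intro finite_imageI fin)
    show "tor_cycles C i (e + i) \<subseteq> fmod.span ?F"
    proof
      fix x assume "x \<in> tor_cycles C i (e + i)"
      then have x: "x \<in> tensor_part C i (e + i)" by (simp add: i)
      have "x = (\<Sum>b\<in>Poly_Mapping.keys x. fscale (Poly_Mapping.lookup x b) (Poly_Mapping.single b 1))"
      proof -
        have "fscale c (Poly_Mapping.single b 1) = Poly_Mapping.single b c" for c :: 'k and b :: nat
          by (rule poly_mapping_eqI) (simp add: lookup_fscale lookup_single when_def)
        then show ?thesis by (simp only: sum_single_lookup[symmetric])
      qed
      also have "\<dots> \<in> fmod.span ?F"
      proof (rule fmod.span_sum)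
        fix b assume "b \<in> Poly_Mapping.keys x"
        then have "Poly_Mapping.single b 1 \<in> ?F" using x by (auto simp: tensor_part_def)
        then show "fscale (Poly_Mapping.lookup x b) (Poly_Mapping.single b 1) \<in> fmod.span ?F"
          by (intro fmod.span_scale fmod.span_base)
      qed
      finally show "x \<in> fmod.span ?F" .
    qed
  qed
  then show ?thesis
    by (simp add: betti_def Let_def flip: C_def)
qed

end

section \<open>Diamonds in modular lattices\<close>

context lattice
begin

text \<open>Dedekind's identities for the two medians $d \leq e$ of three elements: after projection to the
interval from $d$ to $e$ any two of the three elements have meet $d$.  The modular law is used with the
comparable pairs $d \leq e$, $d \leq (b \vee d) \wedge e$ and $c \wedge a \leq a$.\<close>

lemma median_inf_eq:
  fixes a b c :: 'a
  assumes modular: "\<And>a b c. a \<le> c \<Longrightarrow> sup a (inf b c) = inf (sup a b) c"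
  defines "d \<equiv> sup (sup (inf a b) (inf b c)) (inf c a)"
    and "e \<equiv> inf (inf (sup a b) (sup b c)) (sup c a)"
  shows "inf (inf (sup a d) e) (inf (sup b d) e) = d"
proof -
  have de: "d \<le> e"
    unfolding d_def e_def by (simp add: le_infI1 le_infI2 le_supI1 le_supI2)
  have bd: "sup b d = sup b (inf c a)"
    unfolding d_def by (rule order.antisym) (auto simp: le_supI1 le_supI2 le_infI1 le_infI2)
  have ae: "inf a e = inf a (sup b c)"
    unfolding e_def by (rule order.antisym) (auto simp: le_supI1 le_supI2 le_infI1 le_infI2)
  have "inf (inf (sup a d) e) (inf (sup b d) e) = inf (sup d (inf a e)) (inf (sup b d) e)"
    using modular[OF de, of a] by (simp add: sup_commute)
  also have "\<dots> = sup d (inf (inf a e) (inf (sup b d) e))"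
    by (rule modular[symmetric]) (simp add: de)
  also have "inf (inf a e) (inf (sup b d) e) = inf (inf a e) (sup b d)"
    by (rule order.antisym) (auto simp: le_infI1 le_infI2)
  also have "\<dots> = inf (inf a (sup b c)) (sup b (inf c a))"
    by (simp add: ae bd)
  also have "\<dots> = inf a (sup b (inf c a))"
    by (rule order.antisym) (auto simp: le_supI1 le_supI2 le_infI1 le_infI2)
  also have "\<dots> = sup (inf c a) (inf b a)"
    using modular[of "inf c a" a b] by (simp add: sup_commute inf_commute)
  also have "sup d \<dots> = d"
    unfolding d_def by (rule order.antisym) (auto simp: le_supI1 le_supI2 inf_commute)
  finally show ?thesis .
qed

lemmas median_sup_eq = lattice.median_inf_eq[OF dual_lattice]

text \<open>The projections of \<open>a\<close>, \<open>b\<close> and \<open>c\<close> to the interval between the medians form a diamond, unless the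
medians coincide.  They do not, because their meets with \<open>a\<close> are the two sides of the distributive
law at \<open>a\<close>, \<open>b\<close>, \<open>c\<close>.\<close>

lemma modular_imp_diamond:
  fixes a b c :: 'a
  assumes modular: "\<And>a b c. a \<le> c \<Longrightarrow> sup a (inf b c) = inf (sup a b) c"
    and non_distributive: "inf a (sup b c) \<noteq> sup (inf a b) (inf a c)"
  shows "\<exists>y z u v w. y < z \<and> inf u v = y \<and> inf v w = y \<and> inf w u = y \<and>
           sup u v = z \<and> sup v w = z \<and> sup w u = z"
proof -
  define d where "d = sup (sup (inf a b) (inf b c)) (inf c a)"
  define e where "e = inf (inf (sup a b) (sup b c)) (sup c a)"
  have d': "d = sup (sup (inf b c) (inf c a)) (inf a b)" "d = sup (sup (inf c a) (inf a b)) (inf b c)"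
    unfolding d_def by (simp_all add: ac_simps)
  have e': "e = inf (inf (sup b c) (sup c a)) (sup a b)" "e = inf (inf (sup c a) (sup a b)) (sup b c)"
    unfolding e_def by (simp_all add: ac_simps)
  have de: "d \<le> e"
    unfolding d_def e_def by (simp add: le_infI1 le_infI2 le_supI1 le_supI2)
  have dual: "inf a (sup b c) = sup (inf a b) c" if "c \<le> a" for a b c
    using modular[OF that, of b] by (simp add: inf_commute sup_commute)
  have eq: "sup (inf x e) d = inf (sup x d) e" for x
    using modular[OF de, of x] by (simp add: sup_commute)
  have infs: "inf (inf (sup a d) e) (inf (sup b d) e) = d" "inf (inf (sup b d) e) (inf (sup c d) e) = d"
      "inf (inf (sup c d) e) (inf (sup a d) e) = d"
    using median_inf_eq[OF modular, of a b c] median_inf_eq[OF modular, of b c a]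
      median_inf_eq[OF modular, of c a b]
    by (simp_all only: d_def[symmetric] e_def[symmetric] d'[symmetric] e'[symmetric])
  have sups: "sup (inf (sup a d) e) (inf (sup b d) e) = e" "sup (inf (sup b d) e) (inf (sup c d) e) = e"
      "sup (inf (sup c d) e) (inf (sup a d) e) = e"
    using median_sup_eq[OF dual, of a b c] median_sup_eq[OF dual, of b c a]
      median_sup_eq[OF dual, of c a b]
    by (simp_all only: d_def[symmetric] e_def[symmetric] d'[symmetric] e'[symmetric] eq)
  have "inf a e = inf a (sup b c)"
    unfolding e_def by (rule order.antisym) (auto simp: le_supI1 le_supI2 le_infI1 le_infI2)
  moreover have "inf a d = sup (inf a b) (inf a c)"
  proof -
    have "d = sup (sup (inf a b) (inf a c)) (inf b c)"
      unfolding d_def by (simp add: sup_commute sup_left_commute inf_commute)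
    then have "inf a d = sup (sup (inf a b) (inf a c)) (inf (inf b c) a)"
      using modular[of "sup (inf a b) (inf a c)" a "inf b c"] by (simp add: inf_commute)
    also have "\<dots> = sup (inf a b) (inf a c)"
      by (rule order.antisym) (auto simp: le_supI1 le_supI2 le_infI1 le_infI2)
    finally show ?thesis .
  qed
  ultimately have "d \<noteq> e" using non_distributive by auto
  with de have "d < e" by simp
  with infs sups show ?thesis by blast
qed

end

text \<open>An atom \<open>a\<close> of the interval from \<open>y\<close> to one middle element of a diamond is carried by perspectivity to
the other two, and \<open>a\<close> with its images is again a diamond with bottom \<open>y\<close>.  In it \<open>a\<close> is both an atom
and a coatom, so that the interval from \<open>y\<close> to its top \<open>z\<close> has length two, and all elements strictly
between \<open>y\<close> and \<open>z\<close> are pairwise complementary.\<close>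

lemma modular_covering_diamond:
  assumes modular: "\<And>a b c :: 'a::{finite, lattice}. a \<le> c \<Longrightarrow> sup a (inf b c) = inf (sup a b) c"
    and non_distributive: "\<not> (\<forall>a b c :: 'a. inf a (sup b c) = sup (inf a b) (inf a c))"
  shows "\<exists>y z :: 'a. 3 \<le> card {y<..<z} \<and>
           (\<forall>s\<in>{y<..<z}. \<forall>t\<in>{y<..<z}. s \<noteq> t \<longrightarrow> inf s t = y \<and> sup s t = z)"
proof -
  obtain y z0 u v0 w0 :: 'a where yz0: "y < z0" and
    infs0: "inf u v0 = y" "inf v0 w0 = y" "inf w0 u = y" and
    sups0: "sup u v0 = z0" "sup v0 w0 = z0" "sup w0 u = z0"
    using non_distributive modular_imp_diamond[OF modular] by blast
  have y_le: "y \<le> u" "y \<le> v0" "y \<le> w0"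
    using infs0 by (metis inf.cobounded1, metis inf.cobounded2, metis inf.cobounded2)
  have "u \<noteq> y"
  proof
    assume "u = y"
    then have "v0 = z0" "w0 = z0" using sups0 y_le by (simp_all add: sup.absorb1 sup.absorb2)
    then show False using infs0 yz0 by simp
  qed
  with y_le have "y < u" by simp
  then obtain a where a: "y < a" "a \<le> u" and "\<forall>x\<in>{x. y < x \<and> x \<le> u}. x \<le> a \<longrightarrow> a = x"
    using finite_has_minimal[of "{x. y < x \<and> x \<le> u}"] by auto
  then have a_min: "x = a" if "y < x" "x \<le> a" for x
    using that by (auto dest: order_trans)
  \<comment> \<open>the images of \<open>a\<close> under perspectivity, first by way of \<open>w0\<close> and then of \<open>b\<close>\<close>
  define b where "b = inf v0 (sup a w0)"
  define c where "c = inf w0 (sup a b)"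
  define z where "z = sup a b"
  have ya: "y \<le> a" using a by simp
  have yb: "y \<le> b" unfolding b_def using ya y_le by (auto simp: le_supI1)
  have yc: "y \<le> c" unfolding c_def using ya y_le by (auto simp: le_supI1)
  have ab: "inf a b = y"
  proof (rule order.antisym)
    have "inf a b \<le> inf u v0" unfolding b_def by (intro inf_mono a) auto
    then show "inf a b \<le> y" using infs0 by simp
  qed (use ya yb in simp)
  have bc: "inf b c = y"
  proof (rule order.antisym)
    have "inf b c \<le> inf v0 w0" unfolding b_def c_def by (intro inf_mono) auto
    then show "inf b c \<le> y" using infs0 by simp
  qed (use yb yc in simp)
  have ca: "inf c a = y"
  proof (rule order.antisym)
    have "inf c a \<le> inf w0 u" unfolding c_def by (intro inf_mono a) auto
    then show "inf c a \<le> y" using infs0 by simp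
  qed (use ya yc in simp)
  have b_le: "sup a b \<le> sup a w0" unfolding b_def by simp
  have ac: "sup a c = z"
  proof -
    have "sup a c = inf (sup a w0) (sup a b)" unfolding c_def by (rule modular) simp
    also have "\<dots> = sup a b" using b_le by (rule inf.absorb2)
    finally show ?thesis by (simp add: z_def)
  qed
  have bc': "sup b c = z"
  proof -
    have "sup b c = inf (sup b w0) (sup a b)" unfolding c_def by (rule modular) simp
    also have "sup b w0 = inf (sup w0 v0) (sup a w0)"
      using modular[of w0 "sup a w0" v0] by (simp add: b_def sup_commute)
    also have "\<dots> = sup a w0"
    proof (rule inf.absorb2)
      have "sup a w0 \<le> sup u w0" using a by (intro sup_mono) auto
      then show "sup a w0 \<le> sup w0 v0" by (simp only: sups0 sup_commute[of w0 v0] sup_commute[of u w0])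
    qed
    also have "inf (sup a w0) (sup a b) = sup a b" using b_le by (rule inf.absorb2)
    finally show ?thesis by (simp add: z_def)
  qed
  have le_z: "a \<le> z" "b \<le> z" "c \<le> z" unfolding ac[symmetric] bc'[symmetric]
    by (simp, metis bc' ac sup.cobounded1, simp add: ac[symmetric])
  have ab': "sup a b = z" by (simp add: z_def)
  \<comment> \<open>a complement of an atom of the interval is a coatom\<close>
  have coatom: "x = s"
    if atom: "\<And>x. y < x \<Longrightarrow> x \<le> t \<Longrightarrow> x = t" and "inf t s = y" "sup t s = z" "s \<le> x" "x < z" for s t x
  proof -
    have "y \<le> s" using \<open>inf t s = y\<close> by auto
    then have "y \<le> inf t x" using that by (metis inf.cobounded1 le_inf_iff order_trans)
    moreover have "inf t x \<noteq> t"
    proof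
      assume "inf t x = t"
      then have "t \<le> x" by (metis inf.cobounded2)
      then have "sup t s \<le> x" using \<open>s \<le> x\<close> by simp
      then show False using that by simp
    qed
    ultimately have "inf t x = y" using atom[of "inf t x"] by (auto simp: less_le)
    moreover have "sup s (inf t x) = x"
      using modular[OF \<open>s \<le> x\<close>, of t] that by (simp add: sup_commute inf.absorb2)
    ultimately show ?thesis using \<open>y \<le> s\<close> by (simp add: sup.absorb1)
  qed
  have c_max: "x = c" if "c \<le> x" "x < z" for x
    using coatom[of a c x] a_min ca ac that by (simp add: inf_commute)
  have b_min: "x = b" if "y < x" "x \<le> b" for x
  proof -
    have x: "x = inf (sup x c) b"
      using modular[OF that(2), of c] that bc by (simp add: inf_commute sup.absorb1)
    have "sup x c \<le> z" using that le_z by (auto intro: order_trans)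
    then consider "sup x c = c" | "sup x c = z" using c_max[of "sup x c"] by (auto simp: less_le)
    then show ?thesis
    proof cases
      case 1
      then show ?thesis using x bc that by (simp add: inf_commute)
    next
      case 2
      then show ?thesis using x le_z by (simp add: inf.absorb2)
    qed
  qed
  have a_max: "x = a" if "a \<le> x" "x < z" for x
    using coatom[of b a x] b_min ab ab' that by (simp add: inf_commute sup_commute)
  have no_chain: False if "y < s" "s < t" "t < z" for s t
  proof -
    have "\<not> a \<le> s"
      using a_max[of s] a_max[of t] less_trans[OF that(2,3)] less_imp_le[OF that(2)] that by auto
    have "\<not> a \<le> t"
      using a_max[of t] a_min[of s] less_imp_le[OF that(2)] that by auto
    then have "inf a t \<noteq> a" by (metis inf.cobounded2)
    moreover have "y \<le> inf a t" using ya that by simp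
    ultimately have t: "inf a t = y" using a_min[of "inf a t"] by (auto simp: less_le)
    have "sup s a \<le> z" using that le_z by auto
    moreover have "sup s a \<noteq> a" 
    proof
      assume "sup s a = a"
      then have "s \<le> a" by (metis sup.cobounded1)
      then show False using a_min[of s] that \<open>\<not> a \<le> s\<close> by auto
    qed
    ultimately have "sup s a = z" using a_max[of "sup s a"] by (auto simp: less_le)
    moreover have "sup s (inf a t) = inf (sup s a) t"
      using that by (intro modular) simp
    ultimately have "s = t" using t that by (simp add: inf.absorb2 sup.absorb1)
    then show False using that by simp
  qed
  have "y \<noteq> z" using a le_z by auto
  then have neq: "a \<noteq> b" "b \<noteq> c" "c \<noteq> a" using ab bc ca ab' bc' ac by auto
  have inner: "s \<in> {y<..<z}" if "inf s t = y" "sup s t = z" "inf t r = y" "sup t r = z" 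
       "inf r s = y" "sup r s = z" for s t r
  proof -
    have "y \<le> s" "y \<le> t" "y \<le> r" "s \<le> z" "t \<le> z" "r \<le> z"
      using that by (metis inf.cobounded1 sup.cobounded1)+
    moreover have "s \<noteq> y"
    proof
      assume "s = y"
      then have "t = z" "r = z" using that calculation by (simp_all add: sup.absorb1 sup.absorb2)
      then show False using that \<open>y \<noteq> z\<close> by simp
    qed
    moreover have "s \<noteq> z"
    proof
      assume "s = z"
      then have "t = y" "r = y" using that calculation by (simp_all add: inf.absorb1 inf.absorb2)
      then show False using that \<open>y \<noteq> z\<close> by simp
    qed
    ultimately show ?thesis by (simp add: less_le)
  qed
  have "{a, b, c} \<subseteq> {y<..<z}"
    using inner[of a b c] inner[of b c a] inner[of c a b] ab bc ca ab' bc' ac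
    by (simp add: sup_commute)
  then have "card {a, b, c} \<le> card {y<..<z}"
    by (intro card_mono) auto
  then have "3 \<le> card {y<..<z}" using neq by auto
  moreover have "inf s t = y \<and> sup s t = z" if "s \<in> {y<..<z}" "t \<in> {y<..<z}" "s \<noteq> t" for s t
  proof -
    have nle: "\<not> s \<le> t" "\<not> t \<le> s" using no_chain[of s t] no_chain[of t s] that by (auto simp: less_le)
    have "inf s t \<noteq> s" using nle by (metis inf.cobounded2)
    then have 1: "inf s t < s" by (simp add: less_le)
    have "sup s t \<noteq> s" using nle by (metis sup.cobounded2)
    then have 2: "s < sup s t" by (simp add: less_le)
    have "y \<le> inf s t" "sup s t \<le> z" using that by auto
    then show ?thesis
      using no_chain[of "inf s t" s] no_chain[of s "sup s t"] that 1 2 by (auto simp: less_le)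
  qed
  ultimately show ?thesis by blast
qed

section \<open>Certificates for join-meet ideals\<close>

text \<open>The exponent of a single variable, kept opaque to the simplifier, which would otherwise turn the
exponent \<open>1\<close> into a successor.\<close>

definition mon :: "'a \<Rightarrow> ('a \<Rightarrow>\<^sub>0 nat)" where
  "mon a = Poly_Mapping.single a 1"

lemma lookup_mon: "Poly_Mapping.lookup (mon a) b = (if a = b then 1 else 0)"
  by (simp add: mon_def lookup_single when_def)

lemma keys_mon [simp]: "Poly_Mapping.keys (mon a) = {a}"
  by (simp add: mon_def)

lemma keys_add_nat: "Poly_Mapping.keys (m + n :: 'a \<Rightarrow>\<^sub>0 nat) = Poly_Mapping.keys m \<union> Poly_Mapping.keys n"
  by (auto simp: in_keys_iff lookup_add)

lemma mon_eq_iff [simp]: "mon a = mon b \<longleftrightarrow> a = b"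
  by (metis keys_mon singleton_inject)

lemma monomial_degree_mon [simp]: "monomial_degree (mon a) = 1"
  by (simp add: mon_def)

lemma mon_remove: "a \<in> Poly_Mapping.keys m \<Longrightarrow> mon a + (m - mon a) = m"
  by (intro poly_mapping_eqI) (auto simp: lookup_add lookup_minus lookup_mon in_keys_iff)

lemma monomial_degree_1D:
  assumes "monomial_degree (m :: 'a::finite \<Rightarrow>\<^sub>0 nat) = 1"
  shows "\<exists>c. m = mon c"
proof -
  have "m \<noteq> 0" using assms by auto
  then obtain c where c: "c \<in> Poly_Mapping.keys m" by (metis all_not_in_conv keys_eq_empty)
  have "monomial_degree (mon c) + monomial_degree (m - mon c) = 1"
    by (simp only: monomial_degree_add[symmetric] mon_remove[OF c] assms)
  then have "m - mon c = 0" by simp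
  then have "m = mon c" using mon_remove[OF c] by simp
  then show ?thesis by blast
qed

lemma var_mult_var: "var a * var b = Poly_Mapping.single (mon a + mon b) 1"
  by (simp add: var_def mon_def mult_single)

lemma var_mult_var_mult_var: "var a * var b * var c = Poly_Mapping.single (mon a + mon b + mon c) 1"
  by (simp add: var_def mon_def mult_single)

lemma homogeneous_part_single: "monomial_degree m = d \<Longrightarrow> Poly_Mapping.single m c \<in> homogeneous_part d"
  by (simp add: homogeneous_part_def)

lemma homogeneous_part_diff:
  "f \<in> homogeneous_part d \<Longrightarrow> g \<in> homogeneous_part d \<Longrightarrow> f - g \<in> homogeneous_part d"
  using Poly_Mapping.keys_diff[of f g] by (auto simp: homogeneous_part_def)

lemma homogeneous_part_zero: "0 \<in> homogeneous_part d"
  by (simp add: homogeneous_part_def)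

lemma filter_keys_homogeneous:
  assumes "f \<in> homogeneous_part d"
  shows "filter_keys (\<lambda>m. monomial_degree m = j) f = (if d = j then f else 0)"
  using assms by (auto simp: homogeneous_part_def intro!: filter_keys_id filter_keys_none)

lemma single_mult_homogeneous:
  fixes f :: "('a::finite, 'k::comm_ring_1) mpolynomial"
  assumes "f \<in> homogeneous_part d"
  shows "Poly_Mapping.single m c * f \<in> homogeneous_part (monomial_degree m + d)"
  using assms keys_mult[of "Poly_Mapping.single m c" f]
  by (auto simp: homogeneous_part_def split: if_splits)

text \<open>Multiplying a homogeneous generator by a monomial gives a homogeneous element of the span, and these
products generate the span additively.\<close>

lemma homogeneous_span:
  fixes S :: "('a::finite, 'k::comm_ring_1) mpolynomial set"
  assumes S: "S \<subseteq> homogeneous_part d" and f: "f \<in> ring_mod.span S"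
  shows "filter_keys (\<lambda>m. monomial_degree m = j) f \<in> ring_mod.span S"
  using f
proof (induction f rule: ring_mod.span_induct_alt)
  case base
  show ?case by (simp add: ring_mod.span_zero)
next
  case (step c g f)
  let ?H = "filter_keys (\<lambda>m. monomial_degree m = j)"
  have "?H (Poly_Mapping.single n x * g) \<in> ring_mod.span S" for n x
  proof -
    have "Poly_Mapping.single n x * g \<in> homogeneous_part (monomial_degree n + d)"
      using S step.hyps by (intro single_mult_homogeneous) auto
    moreover have "Poly_Mapping.single n x * g \<in> ring_mod.span S"
      using step.hyps by (intro ring_mod.span_scale ring_mod.span_base)
    ultimately show ?thesis
      by (simp add: filter_keys_homogeneous ring_mod.span_zero)
  qed
  then have "?H (c * g) \<in> ring_mod.span S"
    by (subst sum_single_lookup[of c])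
      (simp only: sum_distrib_right filter_keys_sum ring_mod.span_sum)
  then show ?case
    using step.IH by (simp add: filter_keys_add ring_mod.span_add)
qed

lemma subspace_join_meet_ideal: "ring_mod.subspace join_meet_ideal"
  unfolding join_meet_ideal_def by (rule ring_mod.subspace_span)

lemma join_meet_relation:
  "\<not> a \<le> b \<Longrightarrow> \<not> b \<le> a \<Longrightarrow> var a * var b - var (inf a b) * var (sup a b) \<in> join_meet_ideal"
  unfolding join_meet_ideal_def by (rule ring_mod.span_base) blast

lemma join_meet_ideal_homogeneous:
  fixes f :: "('a::{finite, lattice}, 'k::comm_ring_1) mpolynomial"
  assumes "f \<in> join_meet_ideal"
  shows "filter_keys (\<lambda>m. monomial_degree m = j) f \<in> join_meet_ideal"
  using assms unfolding join_meet_ideal_def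
  by (rule homogeneous_span[rotated, where d = 2])
    (auto simp: var_mult_var intro!: homogeneous_part_diff homogeneous_part_single)

text \<open>The ideal is spanned over the ground field by the products of the generators with monomials.\<close>

lemma pairing_join_meet_ideal:
  fixes g :: "('a::{finite, lattice} \<Rightarrow>\<^sub>0 nat) \<Rightarrow> 'k::comm_ring_1"
  assumes inv: "\<And>a b m. \<not> a \<le> b \<Longrightarrow> \<not> b \<le> a \<Longrightarrow>
      g (m + (mon a + mon b)) = g (m + (mon (inf a b) + mon (sup a b)))"
    and p: "p \<in> join_meet_ideal"
  shows "pairing g p = 0"
  using p unfolding join_meet_ideal_def
proof (induction p rule: ring_mod.span_induct_alt)
  case base
  show ?case by simp
next
  case (step c q f)
  from step.hyps obtain a b where ab: "\<not> a \<le> b" "\<not> b \<le> a"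
      "q = var a * var b - var (inf a b) * var (sup a b)" by blast
  have "pairing g (Poly_Mapping.single t 1 * q) = 0" for t
    using inv[OF ab(1,2), of t]
    by (simp add: ab(3) var_mult_var right_diff_distrib mult_single pairing_diff)
  then have "pairing g (c * q) = 0" by (rule pairing_mult_eq_0)
  then show ?case using step.IH by (simp add: pairing_add)
qed

context variable_order
begin

definition delta :: "'a set \<Rightarrow> ('a \<Rightarrow>\<^sub>0 nat) \<Rightarrow> 'a set \<Rightarrow> ('a \<Rightarrow>\<^sub>0 nat) \<Rightarrow> 'k::comm_ring_1" where
  "delta A0 m0 A m = (if A = A0 \<and> m = m0 then 1 else 0)"

text \<open>The transpose of the Koszul differential; functionals on chains are given by their values on the
terms $m\,e_A$, and \<open>delta A0 m0\<close> is the one dual to the term $m_0\,e_{A_0}$.\<close>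

definition coboundary :: "('a set \<Rightarrow> ('a \<Rightarrow>\<^sub>0 nat) \<Rightarrow> 'k::comm_ring_1) \<Rightarrow> 'a set \<Rightarrow> ('a \<Rightarrow>\<^sub>0 nat) \<Rightarrow> 'k" where
  "coboundary \<psi> A m = (\<Sum>a\<in>A. koszul_sign a (A - {a}) * \<psi> (A - {a}) (m + mon a))"

lemma coboundary_add: "coboundary (\<lambda>A m. \<psi> A m + \<phi> A m) A m = coboundary \<psi> A m + coboundary \<phi> A m"
  by (simp add: coboundary_def distrib_left sum.distrib)

lemma coboundary_sum: "coboundary (\<lambda>A m. \<Sum>x\<in>X. \<psi> x A m) A m = (\<Sum>x\<in>X. coboundary (\<psi> x) A m)"
  unfolding coboundary_def sum_distrib_left by (rule sum.swap)

lemma coboundary_scale: "coboundary (\<lambda>A m. c * \<psi> A m) A m = c * coboundary \<psi> A m"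
  unfolding coboundary_def sum_distrib_left by (rule sum.cong[OF refl]) (rule mult.left_commute)

lemma coboundary_delta:
  "coboundary (delta A0 m0) A m =
    (\<Sum>a\<in>Poly_Mapping.keys m0 - A0. koszul_sign a A0 * delta (insert a A0) (m0 - mon a) A m)"
proof -
  have eq: "a \<in> A \<and> A - {a} = A0 \<and> m + mon a = m0 \<longleftrightarrow>
      a \<in> Poly_Mapping.keys m0 - A0 \<and> A = insert a A0 \<and> m = m0 - mon a" for a
    using mon_remove[of a m0] by (auto simp: keys_add_nat add.commute)
  have "coboundary (delta A0 m0) A m =
      (\<Sum>a\<in>UNIV. if a \<in> A \<and> A - {a} = A0 \<and> m + mon a = m0 then koszul_sign a A0 else 0)"
    unfolding coboundary_def delta_def by (rule sum.mono_neutral_cong_left) auto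
  also have "\<dots> = (\<Sum>a\<in>Poly_Mapping.keys m0 - A0. koszul_sign a A0 * delta (insert a A0) (m0 - mon a) A m)"
    unfolding eq delta_def by (rule sum.mono_neutral_cong_right) auto
  finally show ?thesis .
qed

lemma koszul_sign_empty [simp]: "koszul_sign a {} = 1"
  by (simp add: koszul_sign_def)

lemma koszul_sign_singleton_swap: "a \<noteq> b \<Longrightarrow> koszul_sign a {b} = - koszul_sign b {a}"
  using koszul_sign_swap[of a "{}" b] by simp

lemma koszul_diff_single:
  "koszul_diff (*) (\<lambda>A. if A = A0 then p else 0) A =
    (\<Sum>a\<in>A0. if A = A0 - {a} then koszul_sign a (A0 - {a}) * var a * p else 0)"
proof -
  have eq: "a \<in> - A \<and> insert a A = A0 \<longleftrightarrow> a \<in> A0 \<and> A = A0 - {a}" for a by auto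
  have "koszul_diff (*) (\<lambda>A. if A = A0 then p else 0) A =
      (\<Sum>a\<in>UNIV. if a \<in> - A \<and> insert a A = A0 then koszul_sign a A * var a * p else 0)"
    unfolding koszul_diff_def by (rule sum.mono_neutral_cong_left) auto
  also have "\<dots> = (\<Sum>a\<in>A0. if A = A0 - {a} then koszul_sign a (A0 - {a}) * var a * p else 0)"
    unfolding eq by (rule sum.mono_neutral_cong_right) auto
  finally show ?thesis .
qed

lemma koszul_diff_add:
  "koszul_diff (*) (\<lambda>A. f A + g A) A = koszul_diff (*) f A + koszul_diff (*) g A"
  by (simp add: koszul_diff_def distrib_left sum.distrib)

end

section \<open>Koszul classes of an interval of length two\<close>

text \<open>The order of the variables is chosen with \<open>y\<close> and \<open>z\<close> in front, because their signs are then constant.\<close>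

locale rank_two_interval = variable_order idx
  for idx :: "'a::{finite, lattice} \<Rightarrow> nat" +
  fixes y z :: 'a
  assumes card_inner: "3 \<le> card {y<..<z}"
    and inner: "\<And>s t. s \<in> {y<..<z} \<Longrightarrow> t \<in> {y<..<z} \<Longrightarrow> s \<noteq> t \<Longrightarrow> inf s t = y \<and> sup s t = z"
    and idx_y: "idx y = 0" and idx_z: "idx z = 1"
begin

lemma join_meet_class_imp_betti_pos:
  fixes \<psi> :: "'a set \<Rightarrow> ('a \<Rightarrow>\<^sub>0 nat) \<Rightarrow> 'k::field"
  assumes "i > 0"
    and "\<And>A. card A = i \<Longrightarrow> c A \<in> homogeneous_part e" "\<And>A. card A \<noteq> i \<Longrightarrow> c A = 0"
    and "\<And>A. koszul_diff (*) c A \<in> join_meet_ideal"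
    and inv: "\<And>A a b m. \<not> a \<le> b \<Longrightarrow> \<not> b \<le> a \<Longrightarrow>
      \<psi> A (m + (mon a + mon b)) = \<psi> A (m + (mon (inf a b) + mon (sup a b)))"
    and cob: "\<And>A m. coboundary \<psi> A m = 0"
    and "(\<Sum>A\<in>UNIV. pairing (\<psi> A) (c A)) \<noteq> 0"
  shows "betti (join_meet_ideal :: ('a, 'k) mpolynomial set) i (e + i) > 0"
proof -
  obtain i' where i: "i = Suc i'" using assms(1) by (cases i) auto
  show ?thesis
  proof (rule koszul_class_imp_betti_pos[OF subspace_join_meet_ideal join_meet_ideal_homogeneous i assms(2-4)])
    show "pairing (\<psi> A) p = 0" if "p \<in> join_meet_ideal" for A p
      using inv that by (rule pairing_join_meet_ideal)
    show "(\<Sum>a\<in>A. koszul_sign a (A - {a}) * \<psi> (A - {a}) (m + Poly_Mapping.single a 1)) = 0" for A m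
      using cob[of A m] by (simp only: coboundary_def mon_def)
    show "(\<Sum>A\<in>UNIV. pairing (\<psi> A) (c A)) \<noteq> 0" by (rule assms(7))
  qed
qed

abbreviation "N \<equiv> {y<..<z}"

lemma y_less_z: "y < z"
proof -
  have "N \<noteq> {}" using card_inner by auto
  then show ?thesis by (auto intro: less_trans)
qed

lemma y_neq_z: "y \<noteq> z" using y_less_z by auto

lemma incomparable:
  assumes "s \<in> N" "t \<in> N" "s \<noteq> t"
  shows "\<not> s \<le> t"
  using inner[OF assms] assms by (auto simp: inf.absorb1)

lemma relation:
  assumes "s \<in> N" "t \<in> N" "s \<noteq> t"
  shows "var s * var t - var y * var z \<in> join_meet_ideal"
  using join_meet_relation[of s t] incomparable[of s t] incomparable[of t s] inner[of s t] assms by auto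

lemma sign_y: "koszul_sign y A = 1"
  by (rule koszul_sign_least) (simp add: idx_y)

lemma idx_above: "a \<noteq> y \<Longrightarrow> idx y < idx a" "a \<noteq> y \<Longrightarrow> a \<noteq> z \<Longrightarrow> idx z < idx a"
proof -
  have ne: "idx a \<noteq> idx b" if "a \<noteq> b" for a b using that inj_idx by (auto dest: injD)
  show "a \<noteq> y \<Longrightarrow> idx y < idx a" using ne[of a y] by (simp add: idx_y)
  show "a \<noteq> y \<Longrightarrow> a \<noteq> z \<Longrightarrow> idx z < idx a" using ne[of a y] ne[of a z] by (simp add: idx_y idx_z)
qed

lemma sign_z: "y \<notin> A \<Longrightarrow> koszul_sign z A = 1"
  by (rule koszul_sign_least) (metis idx_above(2) le_less)

lemma sign_z_insert: "y \<notin> A \<Longrightarrow> koszul_sign z (insert y A) = - 1"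
  using y_neq_z by (simp add: koszul_sign_insert_below idx_above sign_z)

lemma sign_inner_insert:
  assumes "s \<in> N" "u = y \<or> u = z" "u \<notin> A"
  shows "koszul_sign s (insert u A) = - koszul_sign s A"
  using assms by (intro koszul_sign_insert_below) (auto intro: idx_above)

text \<open>If \<open>q\<close> covers \<open>p\<close>, then a monomial in the variables \<open>p\<close> and \<open>q\<close> does not occur in any multiple of a
generator of the ideal: it has no incomparable variables, and if meet and join of \<open>a\<close> and \<open>b\<close> are both
in $\{p, q\}$, then so are \<open>a\<close> and \<open>b\<close>.\<close>

lemma incomparable_pair_not_in_edge:
  fixes a b p q :: 'a
  assumes edge: "p \<le> q" "\<And>c. p \<le> c \<Longrightarrow> c \<le> q \<Longrightarrow> c = p \<or> c = q"
    and "\<not> a \<le> b" "\<not> b \<le> a" and m0: "Poly_Mapping.keys m0 \<subseteq> {p, q}"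
  shows "m + (mon a + mon b) \<noteq> m0" "m + (mon (inf a b) + mon (sup a b)) \<noteq> m0"
proof -
  show "m + (mon a + mon b) \<noteq> m0"
    using assms by (auto simp: keys_add_nat)
  show "m + (mon (inf a b) + mon (sup a b)) \<noteq> m0"
  proof
    assume "m + (mon (inf a b) + mon (sup a b)) = m0"
    then have "inf a b \<in> {p, q}" "sup a b \<in> {p, q}" using m0 by (auto simp: keys_add_nat)
    moreover have "p \<le> c" "c \<le> q" if "c \<in> {p, q}" for c
      using that edge(1) by auto
    ultimately have "p \<le> inf a b" "sup a b \<le> q" by blast+
    then have "a \<in> {p, q}" "b \<in> {p, q}"
      using edge(2)[of a] edge(2)[of b] by auto
    then show False using assms(1,3,4) by auto
  qed
qed

lemma upper_edge:
  assumes "s \<in> N" "s \<le> c" "c \<le> z"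
  shows "c = s \<or> c = z"
proof -
  have "y < c" using assms by (auto intro: less_le_trans)
  moreover have "c < z" if "c \<noteq> z" using assms(3) that by (rule le_neq_trans)
  ultimately show ?thesis using assms(1,2) incomparable[of s c] by auto
qed

lemma lower_edge:
  assumes "s \<in> N" "y \<le> c" "c \<le> s"
  shows "c = y \<or> c = s"
proof -
  have "c < z" using assms by (auto intro: le_less_trans)
  moreover have "y < c" if "c \<noteq> y" using assms(2) that[symmetric] by (rule le_neq_trans)
  ultimately show ?thesis using assms(1,3) incomparable[of c s] by auto
qed

lemma delta_invariant:
  assumes "s \<in> N" "\<not> a \<le> b" "\<not> b \<le> a"
    and "Poly_Mapping.keys m0 \<subseteq> {s, z} \<or> Poly_Mapping.keys m0 \<subseteq> {y, s}"
  shows "delta A0 m0 A (m + (mon a + mon b)) = 0"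
    "delta A0 m0 A (m + (mon (inf a b) + mon (sup a b))) = 0"
proof -
  have "m + (mon a + mon b) \<noteq> m0 \<and> m + (mon (inf a b) + mon (sup a b)) \<noteq> m0"
    using assms(4)
  proof
    assume "Poly_Mapping.keys m0 \<subseteq> {s, z}"
    then show ?thesis
      using incomparable_pair_not_in_edge[OF _ upper_edge[OF assms(1)] assms(2,3)] assms(1) by (simp add: less_imp_le)
  next
    assume "Poly_Mapping.keys m0 \<subseteq> {y, s}"
    then show ?thesis
      using incomparable_pair_not_in_edge[OF _ lower_edge[OF assms(1)] assms(2,3)] assms(1) by (simp add: less_imp_le)
  qed
  then show "delta A0 m0 A (m + (mon a + mon b)) = 0"
    "delta A0 m0 A (m + (mon (inf a b) + mon (sup a b))) = 0" by (simp_all add: delta_def)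
qed

end

lemma relation_combinations:
  fixes p q r y z :: "'r::comm_ring_1"
  shows "r * (p * p) + z * - (p * y) = p * (p * r - y * z)"
    "- (q * (p * p)) + z * (p * y) = - p * (p * q - y * z)"
    "- r * (p * y) + - q * - (p * y) = y * (p * q - y * z) - y * (p * r - y * z)"
  by (simp_all add: algebra_simps)

context rank_two_interval
begin

text \<open>The relations $pr - yz$ and $pq - yz$ have the Koszul cycles $p\,e_r - y\,e_z$ and $p\,e_q - y\,e_z$.
Their product is the chain
$c = p^2 e_r \wedge e_q + py\, e_z \wedge e_r - py\, e_z \wedge e_q$.
The functional \<open>\<psi>\<close> has the value $1$ at $qz\, e_y \wedge e_p$, $pz\, e_y \wedge e_q$,
$qy\, e_z \wedge e_p$ and $py\, e_z \wedge e_q$; each of the four boundaries in degree $pqyz$ meets two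
of these terms, with opposite signs.  Of the terms of \<open>c\<close> only the last one is seen by \<open>\<psi>\<close>.\<close>

lemma betti_2_4_pos: "betti (join_meet_ideal :: ('a, 'k::field) mpolynomial set) 2 4 > 0"
proof -
  obtain X where X: "X \<subseteq> N" "card X = 3"
    using obtain_subset_with_card_n[OF card_inner] by metis
  then obtain p q r where pqr: "p \<in> N" "q \<in> N" "r \<in> N" "p \<noteq> q" "p \<noteq> r" "q \<noteq> r"
    by (auto simp: card_3_iff)
  have neq: "p \<noteq> y" "p \<noteq> z" "q \<noteq> y" "q \<noteq> z" "r \<noteq> y" "r \<noteq> z"
    "y \<noteq> p" "z \<noteq> p" "y \<noteq> q" "z \<noteq> q" "y \<noteq> r" "z \<noteq> r" "y \<noteq> z" "z \<noteq> y"
    using pqr y_less_z by auto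
  define \<psi> :: "'a set \<Rightarrow> ('a \<Rightarrow>\<^sub>0 nat) \<Rightarrow> 'k" where
    "\<psi> A m = (delta {y, p} (mon q + mon z) A m + delta {y, q} (mon p + mon z) A m) +
      (delta {z, p} (mon q + mon y) A m + delta {z, q} (mon p + mon y) A m)" for A m
  define c :: "'a set \<Rightarrow> ('a, 'k) mpolynomial" where
    "c A = ((if A = {r, q} then koszul_sign r {q} * (var p * var p) else 0) +
       (if A = {z, r} then var p * var y else 0)) + (if A = {z, q} then - (var p * var y) else 0)" for A
  have "betti (join_meet_ideal :: ('a, 'k) mpolynomial set) 2 (2 + 2) > 0"
  proof (rule join_meet_class_imp_betti_pos[where \<psi> = \<psi> and c = c])
    show "(0 :: nat) < 2" by simp
    have "koszul_sign r {q} * (var p * var p) \<in> (homogeneous_part 2 :: ('a, 'k) mpolynomial set)"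
      by (subst koszul_sign_eq_single)
        (simp only: var_mult_var mult_single homogeneous_part_single monomial_degree_add monomial_degree_mon
          monomial_degree_zero add_0_left one_add_one)
    moreover have "var p * var y \<in> (homogeneous_part 2 :: ('a, 'k) mpolynomial set)"
      by (simp add: var_mult_var homogeneous_part_single)
    moreover from this have "- (var p * var y) \<in> (homogeneous_part 2 :: ('a, 'k) mpolynomial set)"
      using homogeneous_part_diff[OF homogeneous_part_zero] by fastforce
    ultimately show "c A \<in> homogeneous_part 2" for A
      using neq pqr by (auto simp: c_def homogeneous_part_zero doubleton_eq_iff)
    show "c A = 0" if "card A \<noteq> 2" for A
    proof -
      have "A \<noteq> {r, q}" "A \<noteq> {z, r}" "A \<noteq> {z, q}" using that neq pqr by auto
      then show ?thesis by (simp add: c_def)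
    qed
    show "koszul_diff (*) c A \<in> join_meet_ideal" for A
    proof -
      let ?s = "koszul_sign r {q} :: ('a, 'k) mpolynomial"
      have signs: "koszul_sign q {r} = - ?s" "koszul_sign z {r} = (1 :: ('a, 'k) mpolynomial)"
        "koszul_sign z {q} = (1 :: ('a, 'k) mpolynomial)"
        "koszul_sign r {z} = (- 1 :: ('a, 'k) mpolynomial)" "koszul_sign q {z} = (- 1 :: ('a, 'k) mpolynomial)"
        using koszul_sign_singleton_swap[of q r] sign_z[of "{r}"] sign_z[of "{q}"]
          sign_inner_insert[of r z "{}"] sign_inner_insert[of q z "{}"] pqr neq by auto
      have sq: "?s * ?s = 1" by (rule koszul_sign_square)
      have "koszul_diff (*) c A =
          (if A = {q} then ?s * var r * (?s * (var p * var p)) else 0) +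
          (if A = {r} then - ?s * var q * (?s * (var p * var p)) else 0) +
          ((if A = {r} then var z * (var p * var y) else 0) +
          (if A = {z} then - var r * (var p * var y) else 0)) +
          ((if A = {q} then var z * - (var p * var y) else 0) +
          (if A = {z} then - var q * - (var p * var y) else 0))"
      proof -
        have "{r, q} - {r} = {q}" "{r, q} - {q} = {r}" "{z, r} - {z} = {r}" "{z, r} - {r} = {z}"
          "{z, q} - {z} = {q}" "{z, q} - {q} = {z}" using pqr neq by auto
        then show ?thesis
          unfolding c_def[abs_def] koszul_diff_add koszul_diff_single
          using pqr neq by (simp add: signs)
      qed
      also have "\<dots> = (if A = {q} then var p * (var p * var r - var y * var z) else 0) +
          ((if A = {r} then - var p * (var p * var q - var y * var z) else 0) +
          (if A = {z} then var y * (var p * var q - var y * var z) - var y * (var p * var r - var y * var z) else 0))"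
      proof -
        have cancel: "?s * a * (?s * b) = a * b" for a b
        proof -
          have "?s * a * (?s * b) = (?s * ?s) * (a * b)" by (simp only: ac_simps)
          then show ?thesis by (simp only: sq mult_1_left)
        qed
        have "{q} \<noteq> {r}" "{q} \<noteq> {z}" "{r} \<noteq> {z}" using pqr neq by auto
        then consider "A = {q}" "A \<noteq> {r}" "A \<noteq> {z}" | "A = {r}" "A \<noteq> {q}" "A \<noteq> {z}"
          | "A = {z}" "A \<noteq> {q}" "A \<noteq> {r}" | "A \<noteq> {q}" "A \<noteq> {r}" "A \<noteq> {z}" by blast
        then show ?thesis
          by cases (simp_all only: if_True if_False cancel mult_minus_left[of ?s] mult_minus_left[of "?s * var q"]
            add_0_left add_0_right simp_thms relation_combinations)
      qed
      also have "\<dots> \<in> join_meet_ideal"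
      proof -
        note ideal = subspace_join_meet_ideal
        have if_in: "(if P then f else 0) \<in> join_meet_ideal" if "f \<in> join_meet_ideal"
          for P and f :: "('a, 'k) mpolynomial"
          by (cases P) (simp_all add: that ring_mod.subspace_0[OF ideal])
        have rel: "var p * var q - var y * var z \<in> (join_meet_ideal :: ('a, 'k) mpolynomial set)"
          "var p * var r - var y * var z \<in> (join_meet_ideal :: ('a, 'k) mpolynomial set)"
          using relation pqr by blast+
        show ?thesis
          by (intro ring_mod.subspace_add[OF ideal] ring_mod.subspace_diff[OF ideal] if_in
            ring_mod.subspace_scale[OF ideal] rel)
      qed
      finally show ?thesis .
    qed
    show "\<psi> A (m + (mon a + mon b)) = \<psi> A (m + (mon (inf a b) + mon (sup a b)))"
      if "\<not> a \<le> b" "\<not> b \<le> a" for A a b m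
    proof -
      have edges: "Poly_Mapping.keys (mon s + mon z) \<subseteq> {s, z} \<or> Poly_Mapping.keys (mon s + mon z) \<subseteq> {y, s}"
        "Poly_Mapping.keys (mon s + mon y) \<subseteq> {s, z} \<or> Poly_Mapping.keys (mon s + mon y) \<subseteq> {y, s}" for s
        by (auto simp: keys_add_nat)
      show ?thesis
        unfolding \<psi>_def delta_invariant[OF pqr(1) that edges(1)] delta_invariant[OF pqr(1) that edges(2)]
          delta_invariant[OF pqr(2) that edges(1)] delta_invariant[OF pqr(2) that edges(2)] ..
    qed
    show "coboundary \<psi> A m = 0" for A m
    proof -
      have *: "coboundary (delta {y, s} (mon t + mon z)) A m =
            (- koszul_sign t {s} * delta {y, s, t} (mon z) A m - delta {y, z, s} (mon t) A m :: 'k)"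
        "coboundary (delta {z, s} (mon t + mon y)) A m =
            (- koszul_sign t {s} * delta {z, s, t} (mon y) A m + delta {y, z, s} (mon t) A m :: 'k)"
        if st: "s \<in> N" "t \<in> N" "s \<noteq> t" for s t
      proof -
        have ne: "s \<noteq> y" "s \<noteq> z" "t \<noteq> y" "t \<noteq> z" "y \<noteq> z" using st y_neq_z by auto
        have keys: "Poly_Mapping.keys (mon t + mon z) - {y, s} = {t, z}"
          "Poly_Mapping.keys (mon t + mon y) - {z, s} = {t, y}"
          using ne st by (auto simp: keys_add_nat)
        have signs: "koszul_sign t {y, s} = (- koszul_sign t {s} :: 'k)"
          "koszul_sign t {z, s} = (- koszul_sign t {s} :: 'k)" "koszul_sign z {y, s} = (- 1 :: 'k)"
          using sign_inner_insert[of t y "{s}"] sign_inner_insert[of t z "{s}"] sign_z_insert[of "{s}"] st ne by auto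
        have sets: "{t, y, s} = {y, s, t}" "{z, y, s} = {y, z, s}" "{t, z, s} = {z, s, t}" by auto
        show "coboundary (delta {y, s} (mon t + mon z)) A m =
            (- koszul_sign t {s} * delta {y, s, t} (mon z) A m - delta {y, z, s} (mon t) A m :: 'k)"
          using ne by (simp add: coboundary_delta keys signs sets)
        show "coboundary (delta {z, s} (mon t + mon y)) A m =
            (- koszul_sign t {s} * delta {z, s, t} (mon y) A m + delta {y, z, s} (mon t) A m :: 'k)"
          using ne by (simp add: coboundary_delta keys signs sets sign_y)
      qed
      have sets: "{y, q, p} = {y, p, q}" "{z, q, p} = {z, p, q}" by auto
      have swap: "koszul_sign p {q} = (- koszul_sign q {p} :: 'k)"
        by (rule koszul_sign_singleton_swap) (rule pqr(4))
      show ?thesis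
        unfolding \<psi>_def[abs_def] coboundary_add using pqr
        by (simp add: * sets swap)
    qed
    show "(\<Sum>A\<in>UNIV. pairing (\<psi> A) (c A)) \<noteq> 0"
    proof -
      have "\<psi> {r, q} m = 0" for m
        using pqr neq by (auto simp: \<psi>_def delta_def doubleton_eq_iff)
      then have "pairing (\<psi> {r, q}) f = 0" for f by (simp add: pairing_def)
      then have "pairing (\<psi> A) (c A) = (if A = {z, q} then - 1 else 0)" for A
        using pqr neq
        by (auto simp: c_def \<psi>_def delta_def doubleton_eq_iff pairing_minus var_mult_var)
      then show ?thesis by simp
    qed
  qed
  then show ?thesis by simp
qed

text \<open>The monomials of degree three that the exchange of $st$ for $yz$, with $s \neq t$ in \<open>N\<close>, connects with
the products $s\,yz$.  The cubes are excluded, as no exchange applies to them.\<close>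

definition top_monomials :: "('a \<Rightarrow>\<^sub>0 nat) set" where
  "top_monomials = {m. Poly_Mapping.keys m \<subseteq> N \<and> monomial_degree m = 3 \<and> (\<forall>s. m \<noteq> mon s + mon s + mon s)}
     \<union> (\<lambda>s. mon s + (mon y + mon z)) ` N"

lemma finite_top_monomials: "finite top_monomials"
  unfolding top_monomials_def
  by (intro finite_UnI finite_imageI finite_subset[OF _ finite_monomials_of_degree[of 3]]) auto

lemma keys_top_monomials: "m \<in> top_monomials \<Longrightarrow> Poly_Mapping.keys m \<subseteq> {y..z}"
  using y_less_z by (auto simp: top_monomials_def keys_add_nat less_imp_le dest!: subsetD)

lemma add_meet_join_in_top_monomials:
  "m + (mon y + mon z) \<in> top_monomials \<longleftrightarrow> m \<in> mon ` N"
proof -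
  have "y \<in> Poly_Mapping.keys (m + (mon y + mon z))" by (simp add: keys_add_nat)
  then have "\<not> Poly_Mapping.keys (m + (mon y + mon z)) \<subseteq> N" by auto
  then show ?thesis by (auto simp: top_monomials_def)
qed

lemma add_pair_in_top_monomials:
  assumes st: "s \<in> N" "t \<in> N" "s \<noteq> t"
  shows "m + (mon s + mon t) \<in> top_monomials \<longleftrightarrow> m \<in> mon ` N"
proof
  assume "m + (mon s + mon t) \<in> top_monomials"
  then consider "Poly_Mapping.keys (m + (mon s + mon t)) \<subseteq> N" "monomial_degree (m + (mon s + mon t)) = 3"
    | u where "u \<in> N" "m + (mon s + mon t) = mon u + (mon y + mon z)"
    unfolding top_monomials_def by auto
  then show "m \<in> mon ` N"
  proof cases
    case 1
    then have "monomial_degree m = 1" by simp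
    then obtain c where "m = mon c" using monomial_degree_1D by blast
    then show ?thesis using 1(1) by (auto simp: keys_add_nat)
  next
    case (2 u)
    have "s \<in> Poly_Mapping.keys (mon u + (mon y + mon z))" "t \<in> Poly_Mapping.keys (mon u + (mon y + mon z))"
      unfolding 2(2)[symmetric] by (simp_all add: keys_add_nat)
    then have "s = u" "t = u" using st by (auto simp: keys_add_nat)
    then show ?thesis using st by simp
  qed
next
  assume "m \<in> mon ` N"
  then obtain c where c: "c \<in> N" "m = mon c" by blast
  have "mon c + (mon s + mon t) \<noteq> mon u + mon u + mon u" for u
  proof
    assume "mon c + (mon s + mon t) = mon u + mon u + mon u"
    then have "Poly_Mapping.keys (mon c + (mon s + mon t)) = Poly_Mapping.keys (mon u + mon u + mon u)" by simp
    then show False using st by (auto simp: keys_add_nat)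
  qed
  then show "m + (mon s + mon t) \<in> top_monomials"
    using st c by (simp add: top_monomials_def keys_add_nat)
qed

lemma top_monomials_invariant:
  assumes "\<not> a \<le> b" "\<not> b \<le> a"
  shows "m + (mon a + mon b) \<in> top_monomials \<longleftrightarrow> m + (mon (inf a b) + mon (sup a b)) \<in> top_monomials"
proof (cases "a \<in> {y..z} \<and> b \<in> {y..z}")
  case True
  then have "a \<in> N" "b \<in> N" using assms by (auto simp: less_le)
  moreover have "a \<noteq> b" using assms by auto
  ultimately show ?thesis
    using inner[of a b] by (simp add: add_pair_in_top_monomials add_meet_join_in_top_monomials)
next
  case False
  then have "\<not> (inf a b \<in> {y..z} \<and> sup a b \<in> {y..z})" by auto
  then have "\<not> Poly_Mapping.keys (m + (mon a + mon b)) \<subseteq> {y..z}"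
    "\<not> Poly_Mapping.keys (m + (mon (inf a b) + mon (sup a b))) \<subseteq> {y..z}"
    using False by (auto simp: keys_add_nat)
  then show ?thesis using keys_top_monomials by blast
qed

text \<open>Only the monomials $s\,yz$ contain variables outside \<open>N\<close>, and these are the only ones that can be
moved to the exterior side.\<close>

lemma coboundary_top_monomials:
  "(\<Sum>m0\<in>top_monomials. coboundary (delta N m0) A m) =
    (\<Sum>s\<in>N. delta (insert y N) (mon s + mon z) A m + delta (insert z N) (mon s + mon y) A m :: 'k::comm_ring_1)"
proof -
  let ?M = "\<lambda>s. mon s + (mon y + mon z)"
  have "coboundary (delta N m0) A m = (0 :: 'k)" if "m0 \<in> top_monomials - ?M ` N" for m0
  proof -
    have "Poly_Mapping.keys m0 - N = {}" using that by (auto simp: top_monomials_def)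
    then show ?thesis by (simp only: coboundary_delta sum.empty)
  qed
  then have "(\<Sum>m0\<in>top_monomials. coboundary (delta N m0) A m :: 'k) = (\<Sum>m0\<in>?M ` N. coboundary (delta N m0) A m)"
    by (intro sum.mono_neutral_right finite_top_monomials) (auto simp: top_monomials_def)
  also have "\<dots> = (\<Sum>s\<in>N. coboundary (delta N (?M s)) A m)"
    by (subst sum.reindex) (simp_all add: inj_on_def)
  also have "\<dots> = (\<Sum>s\<in>N. delta (insert y N) (mon s + mon z) A m + delta (insert z N) (mon s + mon y) A m)"
  proof (rule sum.cong[OF refl])
    fix s assume s: "s \<in> N"
    have keys: "Poly_Mapping.keys (?M s) - N = {y, z}" using s by (auto simp: keys_add_nat)
    have minus: "?M s - mon y = mon s + mon z" "?M s - mon z = mon s + mon y"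
      by (intro poly_mapping_eqI; simp add: lookup_add lookup_minus)+
    show "coboundary (delta N (?M s)) A m =
        (delta (insert y N) (mon s + mon z) A m + delta (insert z N) (mon s + mon y) A m :: 'k)"
      using y_neq_z by (simp add: coboundary_delta keys minus sign_y sign_z)
  qed
  finally show ?thesis .
qed

text \<open>These two functionals are combined so that the second terms cancel; the first terms are those of
\<open>coboundary_top_monomials\<close>.\<close>

lemma coboundary_coatom:
  assumes s: "s \<in> N"
  shows "coboundary (delta (insert y (N - {s})) (mon s + mon s + mon z)) A m =
      (- koszul_sign s (N - {s}) * delta (insert y N) (mon s + mon z) A m
        - delta (insert y (insert z (N - {s}))) (mon s + mon s) A m :: 'k::comm_ring_1)"
    and "coboundary (delta (insert z (N - {s})) (mon s + mon s + mon y)) A m =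
      (- koszul_sign s (N - {s}) * delta (insert z N) (mon s + mon y) A m
        + delta (insert y (insert z (N - {s}))) (mon s + mon s) A m :: 'k)"
proof -
  have ne: "s \<noteq> y" "s \<noteq> z" "y \<noteq> z" using s y_neq_z by auto
  have keys: "Poly_Mapping.keys (mon s + mon s + mon z) - insert y (N - {s}) = {s, z}"
    "Poly_Mapping.keys (mon s + mon s + mon y) - insert z (N - {s}) = {s, y}"
    using ne by (auto simp: keys_add_nat)
  have minus: "mon s + mon s + mon u - mon s = mon s + mon u" "mon s + mon s + mon u - mon u = mon s + mon s" for u :: 'a
    by (intro poly_mapping_eqI; simp add: lookup_add lookup_minus)+
  have sets: "insert s (insert y (N - {s})) = insert y N" "insert s (insert z (N - {s})) = insert z N"
    "insert z (insert y (N - {s})) = insert y (insert z (N - {s}))"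
    using s by auto
  have signs: "koszul_sign s (insert y (N - {s})) = (- koszul_sign s (N - {s}) :: 'k)"
    "koszul_sign s (insert z (N - {s})) = (- koszul_sign s (N - {s}) :: 'k)"
    "koszul_sign z (insert y (N - {s})) = (- 1 :: 'k)"
    using s by (auto intro!: sign_inner_insert sign_z_insert)
  show "coboundary (delta (insert y (N - {s})) (mon s + mon s + mon z)) A m =
      (- koszul_sign s (N - {s}) * delta (insert y N) (mon s + mon z) A m
        - delta (insert y (insert z (N - {s}))) (mon s + mon s) A m :: 'k)"
    using ne by (simp only: coboundary_delta keys) (simp add: minus sets signs)
  show "coboundary (delta (insert z (N - {s})) (mon s + mon s + mon y)) A m =
      (- koszul_sign s (N - {s}) * delta (insert z N) (mon s + mon y) A m
        + delta (insert y (insert z (N - {s}))) (mon s + mon s) A m :: 'k)"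
    using ne by (simp only: coboundary_delta keys) (simp add: minus sets signs sign_y)
qed

text \<open>The chain is $u\,e_z \wedge \bigwedge_{s \in N - \{p\}} e_s$ with $u = y^2z - p^2y$.  The functional is
the sum of the indicator $\omega$ of the terms $m\,e_N$ with \<open>m\<close> in \<open>top_monomials\<close>, which respects the
exchange relations but has a nonzero coboundary, and of the corrections $\kappa_s$ for $s \in N$.  The
latter live on $s^2z$ and $s^2y$, which are monomials on covering pairs, and cancel the coboundary.
On the chain the functional is supported by $\kappa_p$ at the term $p^2y$ of $u$.\<close>

lemma betti_top_pos: "betti (join_meet_ideal :: ('a, 'k::field) mpolynomial set) (card N) (3 + card N) > 0"
proof -
  have "N \<noteq> {}" using card_inner by auto
  then obtain p where p: "p \<in> N" by blast
  have third: "\<exists>r\<in>N. r \<noteq> p \<and> r \<noteq> q" for q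
  proof -
    have "\<not> N \<subseteq> {p, q}"
    proof
      assume "N \<subseteq> {p, q}"
      then have "card N \<le> card {p, q}" by (intro card_mono) auto
      also have "\<dots> \<le> 2" by (simp add: card_insert_if)
      finally show False using card_inner by simp
    qed
    then show ?thesis by auto
  qed
  define \<omega> :: "'a set \<Rightarrow> ('a \<Rightarrow>\<^sub>0 nat) \<Rightarrow> 'k" where
    "\<omega> A m = (\<Sum>m0\<in>top_monomials. delta N m0 A m)" for A m
  define \<kappa> :: "'a \<Rightarrow> 'a set \<Rightarrow> ('a \<Rightarrow>\<^sub>0 nat) \<Rightarrow> 'k" where
    "\<kappa> s A m = koszul_sign s (N - {s}) * (delta (insert y (N - {s})) (mon s + mon s + mon z) A m +
       delta (insert z (N - {s})) (mon s + mon s + mon y) A m)" for s A m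
  define \<psi> where "\<psi> A m = \<omega> A m + (\<Sum>s\<in>N. \<kappa> s A m)" for A m
  let ?A = "insert z (N - {p})"
  define u :: "('a, 'k) mpolynomial" where "u = var y * var y * var z - var p * var p * var y"
  define c where "c A = (if A = ?A then u else 0)" for A
  have \<omega>: "\<omega> A m = (if A = N \<and> m \<in> top_monomials then 1 else 0)" for A m
    by (cases "A = N") (simp_all add: \<omega>_def delta_def finite_top_monomials)
  have card_A: "card ?A = card N" using p card_inner by (simp add: card_Diff_singleton)
  show ?thesis
  proof (rule join_meet_class_imp_betti_pos[where \<psi> = \<psi> and c = c])
    show "0 < card N" using card_inner by simp
    show "c A \<in> homogeneous_part 3" for A
      unfolding c_def u_def var_mult_var_mult_var
      by (simp add: homogeneous_part_zero homogeneous_part_diff homogeneous_part_single)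
    show "c A = 0" if "card A \<noteq> card N" for A
      using that card_A by (auto simp: c_def)
    show "koszul_diff (*) c A \<in> join_meet_ideal" for A
    proof -
      note ideal = subspace_join_meet_ideal
      have yz: "var s * (var y * var z) - var p * (var y * var z) \<in> (join_meet_ideal :: ('a, 'k) mpolynomial set)"
        if s: "s \<in> N" for s
      proof (cases "s = p")
        case False
        \<comment> \<open>both products agree with $prs$ modulo the ideal\<close>
        obtain r where r: "r \<in> N" "r \<noteq> p" "r \<noteq> s" using third[of s] by blast
        have "var s * (var y * var z) - var p * (var y * var z) =
            var p * (var s * var r - var y * var z) - var s * (var p * var r - var y * var z :: ('a, 'k) mpolynomial)"
          by (simp add: algebra_simps)
        also have "\<dots> \<in> join_meet_ideal"
          using s r p by (intro ring_mod.subspace_diff[OF ideal ring_mod.subspace_scale[OF ideal relation]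
            ring_mod.subspace_scale[OF ideal relation]]) auto
        finally show ?thesis .
      qed (simp add: ring_mod.subspace_0[OF ideal])
      have "var a * u \<in> join_meet_ideal" if a: "a \<in> ?A" for a
      proof (cases "a = z")
        case True
        obtain r where r: "r \<in> N" "r \<noteq> p" using third[of p] by blast
        have "var a * u = - (var y * var z) * (var p * var r - var y * var z) +
            var p * (var r * (var y * var z) - var p * (var y * var z))"
          by (simp add: u_def True algebra_simps)
        also have "\<dots> \<in> join_meet_ideal"
          using r p by (intro ring_mod.subspace_add[OF ideal ring_mod.subspace_scale[OF ideal relation]
            ring_mod.subspace_scale[OF ideal yz]]) auto
        finally show ?thesis .
      next
        case False
        then have a: "a \<in> N" "a \<noteq> p" using that by auto
        have "var a * u = var y * (var a * (var y * var z) - var p * (var y * var z)) -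
            (var y * var p) * (var p * var a - var y * var z)"
          by (simp add: u_def algebra_simps)
        also have "\<dots> \<in> join_meet_ideal"
          using a p by (intro ring_mod.subspace_diff[OF ideal ring_mod.subspace_scale[OF ideal yz]
            ring_mod.subspace_scale[OF ideal relation]]) auto
        finally show ?thesis .
      qed
      then have "koszul_sign a B * var a * u \<in> join_meet_ideal" if "a \<in> ?A" for a B
        using that by (simp only: mult.assoc ring_mod.subspace_scale[OF ideal])
      then show ?thesis
        unfolding c_def[abs_def] koszul_diff_single
        by (intro ring_mod.subspace_sum[OF ideal]) (simp add: ring_mod.subspace_0[OF ideal])
    qed
    show "\<psi> A (m + (mon a + mon b)) = \<psi> A (m + (mon (inf a b) + mon (sup a b)))"
      if ab: "\<not> a \<le> b" "\<not> b \<le> a" for A a b m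
    proof -
      have edges: "Poly_Mapping.keys (mon s + mon s + mon z) \<subseteq> {s, z} \<or> Poly_Mapping.keys (mon s + mon s + mon z) \<subseteq> {y, s}"
        "Poly_Mapping.keys (mon s + mon s + mon y) \<subseteq> {s, z} \<or> Poly_Mapping.keys (mon s + mon s + mon y) \<subseteq> {y, s}" for s
        by (auto simp: keys_add_nat)
      have "\<kappa> s A (m + (mon a + mon b)) = 0 \<and> \<kappa> s A (m + (mon (inf a b) + mon (sup a b))) = 0" if "s \<in> N" for s
        unfolding \<kappa>_def delta_invariant[OF that ab edges(1)] delta_invariant[OF that ab edges(2)] by simp
      then show ?thesis
        unfolding \<psi>_def \<omega> using top_monomials_invariant[OF ab, of m] by simp
    qed
    show "coboundary \<psi> A m = 0" for A m
    proof -
      have \<kappa>_cob: "coboundary (\<kappa> s) A m =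
          - (delta (insert y N) (mon s + mon z) A m + delta (insert z N) (mon s + mon y) A m)" if "s \<in> N" for s
      proof -
        let ?e = "koszul_sign s (N - {s}) :: 'k"
        have "coboundary (\<kappa> s) A m = ?e * ((- ?e * delta (insert y N) (mon s + mon z) A m
            - delta (insert y (insert z (N - {s}))) (mon s + mon s) A m) +
          (- ?e * delta (insert z N) (mon s + mon y) A m
            + delta (insert y (insert z (N - {s}))) (mon s + mon s) A m))"
          unfolding \<kappa>_def[abs_def] coboundary_scale coboundary_add coboundary_coatom[OF that] ..
        also have "\<dots> = - (?e * ?e) * (delta (insert y N) (mon s + mon z) A m + delta (insert z N) (mon s + mon y) A m)"
          by (simp add: algebra_simps)
        finally show ?thesis by (simp add: koszul_sign_square)
      qed
      have "(\<Sum>s\<in>N. coboundary (\<kappa> s) A m) =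
          (\<Sum>s\<in>N. - (delta (insert y N) (mon s + mon z) A m + delta (insert z N) (mon s + mon y) A m))"
        by (rule sum.cong[OF refl \<kappa>_cob])
      then show ?thesis
        unfolding \<psi>_def[abs_def] \<omega>_def coboundary_add coboundary_sum coboundary_top_monomials
        by (simp only: sum_negf add.right_inverse)
    qed
    show "(\<Sum>A\<in>UNIV. pairing (\<psi> A) (c A)) \<noteq> 0"
    proof -
      have "z \<in> ?A" "z \<notin> N" by auto
      then have "?A \<noteq> N" by metis
      have "?A \<noteq> insert y (N - {s})" for s using y_neq_z by auto
      moreover have "?A = insert z (N - {s}) \<longleftrightarrow> s = p" if "s \<in> N" for s using that p by auto
      ultimately have \<kappa>: "\<kappa> s ?A m = (if s = p then koszul_sign p (N - {p}) * (if m = mon p + mon p + mon y then 1 else 0) else 0)"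
        if "s \<in> N" for s m using that by (auto simp: \<kappa>_def delta_def)
      have \<psi>: "\<psi> ?A m = koszul_sign p (N - {p}) * (if m = mon p + mon p + mon y then 1 else 0)" for m
        using p \<open>?A \<noteq> N\<close> by (simp add: \<psi>_def \<omega> \<kappa>)
      have "mon y + mon y + mon z \<noteq> mon p + mon p + mon y"
      proof
        assume "mon y + mon y + mon z = mon p + mon p + mon y"
        then have "Poly_Mapping.keys (mon y + mon y + mon z) = Poly_Mapping.keys (mon p + mon p + mon y)" by simp
        then show False using p by (auto simp: keys_add_nat)
      qed
      then have "pairing (\<psi> ?A) u = - koszul_sign p (N - {p})"
        by (simp add: u_def var_mult_var_mult_var pairing_diff \<psi>)
      then have "(\<Sum>A\<in>UNIV. pairing (\<psi> A) (c A)) = (\<Sum>A\<in>UNIV. if A = ?A then - koszul_sign p (N - {p}) else 0)"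
        by (intro sum.cong) (auto simp: c_def)
      also have "\<dots> = - koszul_sign p (N - {p})" by simp
      also have "\<dots> \<noteq> 0"
      proof -
        have "koszul_sign p (N - {p}) * koszul_sign p (N - {p}) = (1 :: 'k)" by (rule koszul_sign_square)
        then show ?thesis by auto
      qed
      finally show ?thesis .
    qed
  qed
qed

end

theorem theorem2p2:
  assumes modular: "\<And>a b c :: 'a::{finite, lattice}. a \<le> c \<Longrightarrow> sup a (inf b c) = inf (sup a b) c"
    and non_distributive: "\<not> (\<forall>a b c :: 'a. inf a (sup b c) = sup (inf a b) (inf a c))"
  shows "let I = (join_meet_ideal :: ('a, 'k::field) mpolynomial set) in
           regularity I \<ge> 3 \<and>
           (betti I 2 4 > 0 \<and> \<not> linearly_related 2 I) \<and>
           \<not> has_linear_resolution 2 I"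
proof -
  obtain y z :: 'a where yz: "3 \<le> card {y<..<z}"
      "\<And>s t. s \<in> {y<..<z} \<Longrightarrow> t \<in> {y<..<z} \<Longrightarrow> s \<noteq> t \<Longrightarrow> inf s t = y \<and> sup s t = z"
    using modular_covering_diamond[OF modular non_distributive] by blast
  have "y \<noteq> z" using yz(1) by auto
  obtain f :: "'a \<Rightarrow> nat" where f: "inj f"
    using finite_imp_inj_to_nat_seg[of "UNIV :: 'a set"] by auto
  define idx where "idx a = (if a = y then 0 else if a = z then 1 else f a + 2)" for a
  interpret rank_two_interval idx y z
  proof
    show "inj idx" using f by (auto simp: inj_def idx_def)
    show "idx y = 0" "idx z = 1" using \<open>y \<noteq> z\<close> by (simp_all add: idx_def)
  qed (use yz in auto)
  let ?I = "join_meet_ideal :: ('a, 'k) mpolynomial set"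
  have b24: "betti ?I 2 4 > 0" by (rule betti_2_4_pos)
  have "betti ?I (card {y<..<z}) (3 + card {y<..<z}) \<noteq> 0" using betti_top_pos by (rule gr_implies_not0)
  then have "ereal (real (3 + card {y<..<z}) - real (card {y<..<z})) \<le> regularity ?I"
    unfolding regularity_def by (intro SUP_upper2[where i = "(card {y<..<z}, 3 + card {y<..<z})"]) auto
  then have reg: "regularity ?I \<ge> 3" by simp
  have "\<not> linearly_related 2 ?I"
    using b24 by (auto simp: linearly_related_def intro!: exI[of _ 4])
  moreover have "\<not> has_linear_resolution 2 ?I"
  proof
    assume "has_linear_resolution 2 ?I"
    then have "betti ?I 2 4 = 0"
      unfolding has_linear_resolution_def by (elim allE[of _ 2] impE allE[of _ 4]) simp_all
    then show False using b24 by simp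
  qed
  ultimately show ?thesis using b24 reg by (simp add: Let_def)
qed

end
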